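(* There exists an absolute constant $C>0$ (depending only on the fixed constant $M$ in the definition of $\dot K^{\pm}_{N,L}$) such that for all $N_1,N_2,L_1,L_2>0$, all signs $\pm_1,\pm_2$, all $r>0$, all $\omega\in\mathbb S^1$, and all $u_1,u_2\in L^2(\mathbb R^{1+2})$ with $\operatorname{supp}\widehat{u_j}\subset\dot K^{\pm_j}_{N_j,L_j}$ for $j=1,2$, $$\left\|\mathfrak B_{\theta_{12}}\bigl(\mathbf P_{\mathbb R\times T_r(\omega)}u_1,\,u_2\bigr)\right\|\le C\,(rL_1L_2)^{1/2}\,\|u_1\|\,\|u_2\|,$$ where $T_r(\omega)\subset\mathbb R^2$ is the strip of width $r$ centered on the line $\mathbb R\omega$.
   Context: Points of $\mathbb R^{1+2}$ are written $X=(\tau,\xi)$ with $\tau\in\mathbb R$, $\xi\in\mathbb R^2$. $\|\cdot\|$ is the norm on $L^2(\mathbb R^{1+2})$, $\widehat u$ is the space-time Fourier transform $\widehat u(\tau,\xi)=\iint e^{-i(t\tau+x\cdot\xi)}u(t,x)\,dt\,dx$, and $\mathbf P_A$ is defined by $\widehat{\mathbf P_Au}=\chi_A\widehat u$. Thickened truncated null cones: for $N,L>0$ and a sign $\pm$, $$\dot K^{\pm}_{N,L}=\{(\tau,\xi)\in\mathbb R^{1+2}:|\xi|\sim N,\ \tau=\pm|\xi|+O(L)\},$$ i.e. $M^{-1}N\le|\xi|\le MN$ and $|\tau\mp|\xi||\le ML$, for a fixed absolute constant $M\ge1$. For nonzero $a,b\in\mathbb R^2$, $\theta(a,b)\in[0,\pi]$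 denotes the angle between them. Given the signs $\pm_1,\pm_2$, the bilinear null form $\mathfrak B_{\theta_{12}}$ is defined by (up to a fixed normalizing constant) $$\mathcal F\bigl[\mathfrak B_{\theta_{12}}(u_1,u_2)\bigr](X_0)=\int \theta(\pm_1\xi_1,\pm_2\xi_2)\,\widehat{u_1}(X_1)\,\widehat{u_2}(X_2)\,\delta(X_0-X_1-X_2)\,dX_1\,dX_2,\qquad X_j=(\tau_j,\xi_j),$$ where $\mathcal F$ is the space-time Fourier transform and $\delta$ is the Dirac delta on $\mathbb R^{1+2}$ (so the integral is over $X_1+X_2=X_0$). *)

theory Defs
  imports "HOL-Analysis.Analysis"
begin

text \<open>A space-time or frequency point is a pair: \<^term>\<open>(t, x)\<close> or \<^term>\<open>(\<tau>, \<xi>)\<close>. The inner product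
  of the product type is the pairing \<open>t \<tau> + x \<bullet> \<xi>\<close>.\<close>

type_synonym spacetime = "real \<times> (real ^ 2)"

definition L2_space :: "('a::euclidean_space \<Rightarrow> complex) set" where
  "L2_space = {u. u \<in> borel_measurable lborel \<and> integrable lborel (\<lambda>X. (cmod (u X))\<^sup>2)}"

definition L2_norm :: "('a::euclidean_space \<Rightarrow> complex) \<Rightarrow> real" where
  "L2_norm u = sqrt (\<integral>X. (cmod (u X))\<^sup>2 \<partial>lborel)"

definition fourier_integral :: "('a::euclidean_space \<Rightarrow> complex) \<Rightarrow> 'a \<Rightarrow> complex" where
  "fourier_integral u \<Xi> = (\<integral>X. exp (- \<i> * complex_of_real (X \<bullet> \<Xi>)) * u X \<partial>lborel)"

text \<open>The Fourier transform of an \<open>L\<^sup>2\<close> function is the \<open>L\<^sup>2\<close> limit of the Fourier integrals of its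
  truncations to balls; the limit exists by Plancherel's theorem and is unique up to null sets, so
  only properties of the chosen representative that hold almost everywhere are meaningful. The
  distance is taken in \<open>[0,\<infinity>]\<close>, as the Bochner integral is 0 for non-integrable functions.\<close>

definition fourier :: "('a::euclidean_space \<Rightarrow> complex) \<Rightarrow> 'a \<Rightarrow> complex" where
  "fourier u = (SOME v. v \<in> L2_space \<and>
     (\<lambda>n::nat. \<integral>\<^sup>+ \<Xi>. ennreal ((cmod (fourier_integral
          (\<lambda>X. indicator (cball 0 (real n)) X * u X) \<Xi> - v \<Xi>))\<^sup>2) \<partial>lborel)
       \<longlonglongrightarrow> 0)"

text \<open>The support of a class of functions modulo null sets: the complement of the largest open set
  on which the function vanishes almost everywhere.\<close>

definition ess_supp :: "('a::euclidean_space \<Rightarrow> complex) \<Rightarrow> 'a set" where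
  "ess_supp v = - \<Union>{U. open U \<and> (AE X in lborel. X \<in> U \<longrightarrow> v X = 0)}"

definition fourier_proj ::
    "'a::euclidean_space set \<Rightarrow> ('a \<Rightarrow> complex) \<Rightarrow> ('a \<Rightarrow> complex)" where
  "fourier_proj A u = (SOME v. v \<in> L2_space \<and>
     (AE X in lborel. fourier v X = indicator A X * fourier u X))"

text \<open>A sign is encoded as a real number \<^term>\<open>s \<in> {-1, 1}\<close>.\<close>

definition thick_cone :: "real \<Rightarrow> real \<Rightarrow> real \<Rightarrow> real \<Rightarrow> spacetime set" where
  "thick_cone M s N L =
     {(\<tau>, \<xi>). N / M \<le> norm \<xi> \<and> norm \<xi> \<le> M * N \<and> \<bar>\<tau> - s * norm \<xi>\<bar> \<le> M * L}"

definition strip :: "real \<Rightarrow> real ^ 2 \<Rightarrow> (real ^ 2) set" where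
  "strip r \<omega> = {\<xi>. infdist \<xi> (span {\<omega>}) \<le> r / 2}"

definition vec_angle :: "'a::real_inner \<Rightarrow> 'a \<Rightarrow> real" where
  "vec_angle a b = arccos ((a \<bullet> b) / (norm a * norm b))"

definition null_form_integrand ::
    "real \<Rightarrow> real \<Rightarrow> (spacetime \<Rightarrow> complex) \<Rightarrow> (spacetime \<Rightarrow> complex)
      \<Rightarrow> spacetime \<Rightarrow> spacetime \<Rightarrow> complex" where
  "null_form_integrand s1 s2 u1 u2 X0 X1 =
     complex_of_real (vec_angle (s1 *\<^sub>R snd X1) (s2 *\<^sub>R snd (X0 - X1)))
       * fourier u1 X1 * fourier u2 (X0 - X1)"

text \<open>The delta function in the bilinear integral is resolved by \<open>X\<^sub>2 = X\<^sub>0 - X\<^sub>1\<close>, and the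
  normalizing constant is taken to be 1. The integral is required to converge absolutely for
  almost every \<open>X\<^sub>0\<close>, so that its value is never the default value 0.\<close>

definition is_null_form ::
    "real \<Rightarrow> real \<Rightarrow> (spacetime \<Rightarrow> complex) \<Rightarrow> (spacetime \<Rightarrow> complex)
      \<Rightarrow> (spacetime \<Rightarrow> complex) \<Rightarrow> bool" where
  "is_null_form s1 s2 u1 u2 w \<longleftrightarrow> w \<in> L2_space \<and>
     (AE X0 in lborel. integrable lborel (null_form_integrand s1 s2 u1 u2 X0) \<and>
        fourier w X0 = (\<integral>X1. null_form_integrand s1 s2 u1 u2 X0 X1 \<partial>lborel))"

definition null_form ::
    "real \<Rightarrow> real \<Rightarrow> (spacetime \<Rightarrow> complex) \<Rightarrow> (spacetime \<Rightarrow> complex)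
      \<Rightarrow> (spacetime \<Rightarrow> complex)" where
  "null_form s1 s2 u1 u2 = (SOME w. is_null_form s1 s2 u1 u2 w)"

end

theory Submission
  imports Defs "HOL-Probability.Characteristic_Functions"
begin

text \<open>Cauchy--Schwarz in \<open>X1\<close> reduces the estimate to bounding, uniformly in \<open>X0\<close>, the integral of
  \<open>\<theta>\<^sup>2\<close> over those \<open>X1\<close> in the first cone and the strip for which \<open>X0 - X1\<close> lies in the second cone.
  Integrating out \<open>\<tau>1\<close> costs \<open>min L1 L2\<close> and leaves the condition
  \<open>s1 \<bar>\<xi>\<bar> + s2 \<bar>q - \<xi>\<bar> = \<tau> + O(max L1 L2)\<close>. Along each ray from the origin the phase
  on the left is monotone with derivative \<open>\<plusminus>(1 - cos \<theta>)\<close>, which is comparable to \<open>\<theta>\<^sup>2\<close>, so every ray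
  contributes \<open>O(max L1 L2)\<close> to the radial integral of \<open>\<theta>\<^sup>2\<close>. The directions allowed by the strip
  have measure \<open>O(r / N1)\<close>, and the Jacobian \<open>O(N1)\<close> of polar (here: slope) coordinates turns this
  into \<open>O(r)\<close>. Plancherel's theorem and the surjectivity of the Fourier transform on \<open>L\<^sup>2\<close>
  provide the functions whose transforms are prescribed; the isometry comes from Gaussian
  regularization.\<close>

section \<open>Square integrable functions\<close>

text \<open>No lower bound on the angle and no transversality of the cones is used: the weight
  \<theta>^2 degenerates exactly where the radial derivative of the phase does, so the degenerate
  directions need no separate treatment. Rays issue from the origin of the \<xi>1 plane because the
  strip is a condition on \<xi>1 alone. Slopes replace polar coordinates so that linear
  substitutions and Fubini suffice; the price is a second chart when r is at least N1 / (4 M), since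
  the strip then need not restrict the directions. The analytic half is forced by
  \<open>SOME\<close>: transform, projection and null form are all choices, about which nothing is
  known before a witness has been exhibited. This requires completeness of L2, surjectivity of the
  transform and almost everywhere absolute convergence of the bilinear integral. Representatives are
  determined only up to null sets, so the bilinear bound is proved for functions that vanish at
  every point off the cones and is transferred afterwards.\<close>

lemma L2_spaceD:
  assumes "u \<in> L2_space"
  shows "u \<in> borel_measurable borel" "integrable lborel (\<lambda>x. (cmod (u x))\<^sup>2)"
  using assms by (auto simp: L2_space_def)

lemma L2_spaceI_nn:
  fixes u :: "'a::euclidean_space \<Rightarrow> complex"
  assumes [measurable]: "u \<in> borel_measurable borel"
    and "(\<integral>\<^sup>+x. ennreal ((cmod (u x))\<^sup>2) \<partial>lborel) < \<infinity>"
  shows "u \<in> L2_space"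
  using assms(2) by (auto simp: L2_space_def integrable_iff_bounded)

lemma nn_integral_L2:
  fixes u :: "'a::euclidean_space \<Rightarrow> complex"
  assumes "u \<in> L2_space"
  shows "(\<integral>\<^sup>+x. ennreal ((cmod (u x))\<^sup>2) \<partial>lborel) = ennreal ((L2_norm u)\<^sup>2)"
  using L2_spaceD[OF assms] by (simp add: L2_norm_def nn_integral_eq_integral)

lemma L2_norm_sq: "(L2_norm u)\<^sup>2 = (\<integral>x. (cmod (u x))\<^sup>2 \<partial>lborel)"
  by (simp add: L2_norm_def)

lemma L2_norm_nonneg [simp]: "0 \<le> L2_norm u"
  by (simp add: L2_norm_def)

lemma L2_norm_le_nn:
  fixes u :: "'a::euclidean_space \<Rightarrow> complex"
  assumes [measurable]: "u \<in> borel_measurable borel"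
    and le: "(\<integral>\<^sup>+x. ennreal ((cmod (u x))\<^sup>2) \<partial>lborel) \<le> ennreal (B\<^sup>2)" and B: "0 \<le> B"
  shows "u \<in> L2_space" "L2_norm u \<le> B"
proof -
  show u: "u \<in> L2_space"
    using le by (intro L2_spaceI_nn) (auto intro: le_less_trans)
  show "L2_norm u \<le> B"
    using le B by (simp add: nn_integral_L2[OF u])
qed

lemma L2_norm_minus: "L2_norm (\<lambda>x. u x - v x) = L2_norm (\<lambda>x. v x - u x)"
  by (simp add: L2_norm_def norm_minus_commute)

lemma L2_norm_cnj: "L2_norm (\<lambda>x. cnj (u x)) = L2_norm u"
  by (simp add: L2_norm_def)

lemma L2_space_cnj: "u \<in> L2_space \<Longrightarrow> (\<lambda>x. cnj (u x)) \<in> L2_space"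
  by (auto simp: L2_space_def intro!: borel_measurable_continuous_on[of cnj] continuous_intros)

lemma L2_space_add:
  fixes u v :: "'a::euclidean_space \<Rightarrow> complex"
  assumes "u \<in> L2_space" "v \<in> L2_space"
  shows "(\<lambda>x. u x + v x) \<in> L2_space"
proof -
  note [measurable] = L2_spaceD(1)[OF assms(1)] L2_spaceD(1)[OF assms(2)]
  have "integrable lborel (\<lambda>x. (cmod (u x + v x))\<^sup>2)"
  proof (rule Bochner_Integration.integrable_bound)
    show "integrable lborel (\<lambda>x. 2 * (cmod (u x))\<^sup>2 + 2 * (cmod (v x))\<^sup>2)"
      using L2_spaceD(2)[OF assms(1)] L2_spaceD(2)[OF assms(2)] by simp
    have "(cmod (a + b))\<^sup>2 \<le> 2 * (cmod a)\<^sup>2 + 2 * (cmod b)\<^sup>2" for a b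
    proof -
      have "(cmod (a + b))\<^sup>2 \<le> (cmod a + cmod b)\<^sup>2"
        by (intro power_mono norm_triangle_ineq norm_ge_zero)
      also have "\<dots> \<le> 2 * (cmod a)\<^sup>2 + 2 * (cmod b)\<^sup>2"
        using sum_squares_bound[of "cmod a" "cmod b"] by (simp add: power2_sum)
      finally show ?thesis .
    qed
    then show "AE x in lborel. norm ((cmod (u x + v x))\<^sup>2)
        \<le> norm (2 * (cmod (u x))\<^sup>2 + 2 * (cmod (v x))\<^sup>2)"
      by (auto intro!: AE_I2 order_trans[OF _ abs_ge_self])
  qed measurable
  then show ?thesis by (simp add: L2_space_def)
qed

lemma L2_space_mult_bounded:
  fixes u :: "'a::euclidean_space \<Rightarrow> complex"
  assumes u: "u \<in> L2_space" and [measurable]: "c \<in> borel_measurable borel"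
    and c: "\<And>x. cmod (c x) \<le> B"
  shows "(\<lambda>x. c x * u x) \<in> L2_space"
proof -
  note [measurable] = L2_spaceD(1)[OF u]
  have "integrable lborel (\<lambda>x. (cmod (c x * u x))\<^sup>2)"
  proof (rule Bochner_Integration.integrable_bound)
    show "integrable lborel (\<lambda>x. B\<^sup>2 * (cmod (u x))\<^sup>2)"
      using L2_spaceD(2)[OF u] by simp
    have "(cmod (c x))\<^sup>2 * (cmod (u x))\<^sup>2 \<le> B\<^sup>2 * (cmod (u x))\<^sup>2" for x
      using c[of x] by (intro mult_right_mono power_mono) auto
    then show "AE x in lborel. norm ((cmod (c x * u x))\<^sup>2) \<le> norm (B\<^sup>2 * (cmod (u x))\<^sup>2)"
      by (auto simp: norm_mult power_mult_distrib)
  qed measurable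
  then show ?thesis by (simp add: L2_space_def)
qed

lemma L2_space_scale: "u \<in> L2_space \<Longrightarrow> (\<lambda>x. c * u x) \<in> L2_space"
  by (rule L2_space_mult_bounded[where B="cmod c"]) auto

lemma L2_space_indicator:
  "u \<in> L2_space \<Longrightarrow> A \<in> sets borel \<Longrightarrow> (\<lambda>x. indicator A x * u x) \<in> L2_space"
  by (rule L2_space_mult_bounded[where B=1]) (auto simp: indicator_def)

lemma L2_space_diff:
  assumes "u \<in> L2_space" "v \<in> L2_space"
  shows "(\<lambda>x. u x - v x) \<in> L2_space"
  using L2_space_add[OF assms(1) L2_space_scale[OF assms(2), of "-1"]] by simp

text \<open>Cauchy-Schwarz is applied to extended nonnegative integrals, so integrability and the
  bound come out of one estimate. The pairing is bilinear, without a conjugate, to match the shape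
  of the multiplication formula for the transform.\<close>

lemma
  fixes u v :: "'a::euclidean_space \<Rightarrow> complex"
  assumes u: "u \<in> L2_space" and v: "v \<in> L2_space"
  shows L2_pair_integrable: "integrable lborel (\<lambda>x. u x * v x)"
    and L2_pair_le: "(\<integral>x. cmod (u x * v x) \<partial>lborel) \<le> L2_norm u * L2_norm v"
proof -
  note [measurable] = L2_spaceD(1)[OF u] L2_spaceD(1)[OF v]
  let ?I = "\<integral>\<^sup>+x. ennreal (cmod (u x * v x)) \<partial>lborel"
  have "?I\<^sup>2 = (\<integral>\<^sup>+x. ennreal (cmod (u x)) * ennreal (cmod (v x)) \<partial>lborel)\<^sup>2"
    by (simp add: norm_mult ennreal_mult)
  also have "\<dots> \<le> (\<integral>\<^sup>+x. (ennreal (cmod (u x)))\<^sup>2 \<partial>lborel) * (\<integral>\<^sup>+x. (ennreal (cmod (v x)))\<^sup>2 \<partial>lborel)"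
    by (rule Cauchy_Schwarz_nn_integral) measurable
  also have "\<dots> = (ennreal (L2_norm u * L2_norm v))\<^sup>2"
    using nn_integral_L2[OF u] nn_integral_L2[OF v]
    by (simp add: ennreal_power power_mult_distrib ennreal_mult)
  finally have *: "?I \<le> ennreal (L2_norm u * L2_norm v)"
    by (cases ?I) (auto simp: ennreal_power ennreal_top_mult power2_eq_square ennreal_mult_eq_top_iff
        top_unique simp flip: ennreal_mult intro: power2_le_imp_le)
  show i: "integrable lborel (\<lambda>x. u x * v x)"
    using * by (auto simp: integrable_iff_bounded intro: le_less_trans)
  have "ennreal (\<integral>x. cmod (u x * v x) \<partial>lborel) = ?I"
    using i by (subst nn_integral_eq_integral) auto
  with * show "(\<integral>x. cmod (u x * v x) \<partial>lborel) \<le> L2_norm u * L2_norm v"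
    by (metis L2_norm_nonneg ennreal_le_iff mult_nonneg_nonneg)
qed

lemma L2_norm_triangle:
  fixes u v :: "'a::euclidean_space \<Rightarrow> complex"
  assumes u: "u \<in> L2_space" and v: "v \<in> L2_space"
  shows "L2_norm (\<lambda>x. u x + v x) \<le> L2_norm u + L2_norm v"
proof (rule power2_le_imp_le)
  have I: "integrable lborel (\<lambda>x. cmod (u x * v x))"
    using L2_pair_integrable[OF u v] by (rule integrable_norm)
  have le: "(cmod (a + b))\<^sup>2 \<le> (cmod a)\<^sup>2 + 2 * cmod (a * b) + (cmod b)\<^sup>2" for a b
  proof -
    have "(cmod (a + b))\<^sup>2 \<le> (cmod a + cmod b)\<^sup>2"
      by (intro power_mono norm_triangle_ineq norm_ge_zero)
    then show ?thesis by (simp add: power2_sum norm_mult)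
  qed
  have "(L2_norm (\<lambda>x. u x + v x))\<^sup>2
      \<le> (\<integral>x. (cmod (u x))\<^sup>2 + 2 * cmod (u x * v x) + (cmod (v x))\<^sup>2 \<partial>lborel)"
    unfolding L2_norm_sq
    using I L2_spaceD(2)[OF u] L2_spaceD(2)[OF v] L2_spaceD(2)[OF L2_space_add[OF u v]] le
    by (intro integral_mono) auto
  also have "\<dots> = (L2_norm u)\<^sup>2 + 2 * (\<integral>x. cmod (u x * v x) \<partial>lborel) + (L2_norm v)\<^sup>2"
    unfolding L2_norm_sq
    using I L2_spaceD(2)[OF u] L2_spaceD(2)[OF v] by simp
  also have "\<dots> \<le> (L2_norm u + L2_norm v)\<^sup>2"
    using L2_pair_le[OF u v] by (simp add: power2_sum)
  finally show "(L2_norm (\<lambda>x. u x + v x))\<^sup>2 \<le> (L2_norm u + L2_norm v)\<^sup>2" .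
qed simp

lemma L2_norm_triangle_diff:
  assumes "u \<in> L2_space" "v \<in> L2_space" "w \<in> L2_space"
  shows "L2_norm (\<lambda>x. u x - w x) \<le> L2_norm (\<lambda>x. u x - v x) + L2_norm (\<lambda>x. v x - w x)"
  using L2_norm_triangle[OF L2_space_diff[OF assms(1,2)] L2_space_diff[OF assms(2,3)]] by simp

lemma L2_norm_diff_abs:
  assumes u: "u \<in> L2_space" and v: "v \<in> L2_space"
  shows "\<bar>L2_norm u - L2_norm v\<bar> \<le> L2_norm (\<lambda>x. u x - v x)"
  using L2_norm_triangle[OF L2_space_diff[OF u v] v] L2_norm_triangle[OF L2_space_diff[OF v u] u]
    L2_norm_minus[of u v] by simp

lemma L2_norm_cong_AE:
  fixes u v :: "'a::euclidean_space \<Rightarrow> complex"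
  assumes "u \<in> borel_measurable borel" "v \<in> borel_measurable borel" "AE x in lborel. u x = v x"
  shows "L2_norm u = L2_norm v"
  unfolding L2_norm_def using assms
  by (intro arg_cong[where f=sqrt] integral_cong_AE) auto

lemma L2_norm_zero_AE:
  fixes u :: "'a::euclidean_space \<Rightarrow> complex"
  assumes u: "u \<in> L2_space" and "L2_norm u = 0"
  shows "AE x in lborel. u x = 0"
proof -
  have "(\<integral>x. (cmod (u x))\<^sup>2 \<partial>lborel) = 0"
    using assms(2) L2_norm_sq[of u] by simp
  then show ?thesis
    using integral_nonneg_eq_0_iff_AE[OF L2_spaceD(2)[OF u]] by simp
qed

section \<open>Convergence and completeness in L2\<close>

lemma L2_tendsto_norm:
  assumes "\<And>n. f n \<in> L2_space" "g \<in> L2_space" "(\<lambda>n. L2_norm (\<lambda>x. f n x - g x)) \<longlonglongrightarrow> 0"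
  shows "(\<lambda>n. L2_norm (f n)) \<longlonglongrightarrow> L2_norm g"
proof (rule Lim_null_comparison[THEN LIM_zero_cancel])
  show "\<forall>\<^sub>F n in sequentially. norm (L2_norm (f n) - L2_norm g) \<le> L2_norm (\<lambda>x. f n x - g x)"
    using L2_norm_diff_abs[OF assms(1,2)] by simp
qed (fact assms(3))

text \<open>Splitting the difference as (f - g) f' + g (f' - g') leaves two Cauchy-Schwarz terms,
  and the norms of \<open>f' n\<close> converge. It carries the multiplication formula from
  truncations to all of L2.\<close>

lemma L2_pair_tendsto:
  assumes f: "\<And>n. f n \<in> L2_space" "g \<in> L2_space" "(\<lambda>n. L2_norm (\<lambda>x. f n x - g x)) \<longlonglongrightarrow> 0"
    and f': "\<And>n. f' n \<in> L2_space" "g' \<in> L2_space" "(\<lambda>n. L2_norm (\<lambda>x. f' n x - g' x)) \<longlonglongrightarrow> 0"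
  shows "(\<lambda>n. \<integral>x. f n x * f' n x \<partial>lborel) \<longlonglongrightarrow> (\<integral>x. g x * g' x \<partial>lborel)"
proof (rule Lim_null_comparison[THEN LIM_zero_cancel])
  let ?e = "\<lambda>n. L2_norm (\<lambda>x. f n x - g x) * L2_norm (f' n)
      + L2_norm g * L2_norm (\<lambda>x. f' n x - g' x)"
  have "?e \<longlonglongrightarrow> 0 * L2_norm g' + L2_norm g * 0"
    using f f' by (intro tendsto_intros L2_tendsto_norm)
  then show "?e \<longlonglongrightarrow> 0" by simp
  have "norm ((\<integral>x. f n x * f' n x \<partial>lborel) - (\<integral>x. g x * g' x \<partial>lborel)) \<le> ?e n" for n
  proof -
    note d1 = L2_space_diff[OF f(1,2), of n] and d2 = L2_space_diff[OF f'(1,2), of n]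
    have "(\<integral>x. f n x * f' n x \<partial>lborel) - (\<integral>x. g x * g' x \<partial>lborel)
        = (\<integral>x. f n x * f' n x - g x * g' x \<partial>lborel)"
      using f f' by (intro Bochner_Integration.integral_diff[symmetric] L2_pair_integrable)
    also have "\<dots> = (\<integral>x. (f n x - g x) * f' n x + g x * (f' n x - g' x) \<partial>lborel)"
      by (simp add: algebra_simps)
    also have "\<dots> = (\<integral>x. (f n x - g x) * f' n x \<partial>lborel) + (\<integral>x. g x * (f' n x - g' x) \<partial>lborel)"
      using L2_pair_integrable[OF d1 f'(1)] L2_pair_integrable[OF f(2) d2]
      by (rule Bochner_Integration.integral_add)
    also have "norm \<dots> \<le> norm (\<integral>x. (f n x - g x) * f' n x \<partial>lborel)
        + norm (\<integral>x. g x * (f' n x - g' x) \<partial>lborel)"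
      by (rule norm_triangle_ineq)
    also have "\<dots> \<le> ?e n"
      by (intro add_mono order_trans[OF integral_norm_bound] L2_pair_le d1 d2 f f')
    finally show ?thesis .
  qed
  then show "\<forall>\<^sub>F n in sequentially. norm ((\<integral>x. f n x * f' n x \<partial>lborel) - (\<integral>x. g x * g' x \<partial>lborel)) \<le> ?e n"
    by simp
qed

text \<open>For fixed m, Fatou's lemma in n bounds the distance of \<open>f m\<close> to the
  pointwise limit by the Cauchy tail. Membership of \<open>g\<close> in L2 is a conclusion, which is
  what later makes a Fourier integral square integrable.\<close>

lemma L2_Fatou:
  fixes f :: "nat \<Rightarrow> 'a::euclidean_space \<Rightarrow> complex"
  assumes f: "\<And>n. f n \<in> L2_space" and [measurable]: "g \<in> borel_measurable borel"
    and lim: "AE x in lborel. (\<lambda>n. f n x) \<longlonglongrightarrow> g x"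
    and Cauchy: "\<And>e. e > 0 \<Longrightarrow> \<exists>N. \<forall>m\<ge>N. \<forall>n\<ge>N. L2_norm (\<lambda>x. f m x - f n x) \<le> e"
  shows "g \<in> L2_space" "(\<lambda>n. L2_norm (\<lambda>x. f n x - g x)) \<longlonglongrightarrow> 0"
proof -
  note [measurable] = L2_spaceD(1)[OF f]
  have *: "(\<lambda>x. f m x - g x) \<in> L2_space \<and> L2_norm (\<lambda>x. f m x - g x) \<le> e"
    if N: "\<And>m n. m \<ge> N \<Longrightarrow> n \<ge> N \<Longrightarrow> L2_norm (\<lambda>x. f m x - f n x) \<le> e" and m: "m \<ge> N" and e: "e \<ge> 0" for N m e
  proof -
    have "(\<integral>\<^sup>+x. ennreal ((cmod (f m x - g x))\<^sup>2) \<partial>lborel)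
        = (\<integral>\<^sup>+x. liminf (\<lambda>n. ennreal ((cmod (f m x - f n x))\<^sup>2)) \<partial>lborel)"
    proof (rule nn_integral_cong_AE, use lim in eventually_elim)
      fix x assume "(\<lambda>n. f n x) \<longlonglongrightarrow> g x"
      then have "(\<lambda>n. ennreal ((cmod (f m x - f n x))\<^sup>2)) \<longlonglongrightarrow> ennreal ((cmod (f m x - g x))\<^sup>2)"
        by (intro tendsto_intros)
      then show "ennreal ((cmod (f m x - g x))\<^sup>2) = liminf (\<lambda>n. ennreal ((cmod (f m x - f n x))\<^sup>2))"
        by (rule lim_imp_Liminf[OF sequentially_bot, symmetric])
    qed
    also have "\<dots> \<le> liminf (\<lambda>n. \<integral>\<^sup>+x. ennreal ((cmod (f m x - f n x))\<^sup>2) \<partial>lborel)"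
      by (rule nn_integral_liminf) measurable
    also have "\<dots> \<le> ennreal (e\<^sup>2)"
    proof (rule Liminf_le)
      have "(\<integral>\<^sup>+x. ennreal ((cmod (f m x - f n x))\<^sup>2) \<partial>lborel) \<le> ennreal (e\<^sup>2)" if "n \<ge> N" for n
        using N[OF m that] e
        by (simp add: nn_integral_L2[OF L2_space_diff[OF f f]] power_mono)
      then show "\<forall>\<^sub>F n in sequentially. (\<integral>\<^sup>+x. ennreal ((cmod (f m x - f n x))\<^sup>2) \<partial>lborel) \<le> ennreal (e\<^sup>2)"
        by (auto simp: eventually_sequentially)
    qed simp
    finally show ?thesis
      using L2_norm_le_nn[of "\<lambda>x. f m x - g x" e] e by simp
  qed
  obtain N where "\<forall>m\<ge>N. \<forall>n\<ge>N. L2_norm (\<lambda>x. f m x - f n x) \<le> 1"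
    using Cauchy[of 1] by auto
  then have "(\<lambda>x. f N x - g x) \<in> L2_space"
    using *[of N 1 N] by auto
  from L2_space_diff[OF f[of N] this] show "g \<in> L2_space" by simp
  show "(\<lambda>n. L2_norm (\<lambda>x. f n x - g x)) \<longlonglongrightarrow> 0"
  proof (rule LIMSEQ_I)
    fix e :: real assume e: "e > 0"
    then obtain N where "\<forall>m\<ge>N. \<forall>n\<ge>N. L2_norm (\<lambda>x. f m x - f n x) \<le> e/2"
      using Cauchy[of "e/2"] by auto
    then have "\<forall>m\<ge>N. L2_norm (\<lambda>x. f m x - g x) \<le> e/2"
      using *[of N "e/2"] e by auto
    then show "\<exists>N. \<forall>n\<ge>N. norm (L2_norm (\<lambda>x. f n x - g x) - 0) < e"
      using e by (intro exI[of _ N]) force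
  qed
qed

lemma L2_dominated_convergence:
  fixes f :: "nat \<Rightarrow> 'a::euclidean_space \<Rightarrow> complex"
  assumes [measurable]: "\<And>n. f n \<in> borel_measurable borel" "g \<in> borel_measurable borel"
    and lim: "AE x in lborel. (\<lambda>n. f n x) \<longlonglongrightarrow> g x"
    and w: "w \<in> L2_space" and le: "\<And>n x. cmod (f n x) \<le> cmod (w x)"
  shows "(\<lambda>n. L2_norm (\<lambda>x. f n x - g x)) \<longlonglongrightarrow> 0"
proof -
  note [measurable] = L2_spaceD(1)[OF w]
  have "(\<lambda>n. \<integral>x. (cmod (f n x - g x))\<^sup>2 \<partial>lborel) \<longlonglongrightarrow> (\<integral>x. 0 \<partial>(lborel::'a measure))"
  proof (rule integral_dominated_convergence)
    show "integrable lborel (\<lambda>x. 4 * (cmod (w x))\<^sup>2)"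
      using L2_spaceD(2)[OF w] by simp
    show "AE x in lborel. (\<lambda>n. (cmod (f n x - g x))\<^sup>2) \<longlonglongrightarrow> 0"
      using lim
    proof eventually_elim
      case (elim x)
      then have "(\<lambda>n. (cmod (f n x - g x))\<^sup>2) \<longlonglongrightarrow> (cmod (g x - g x))\<^sup>2"
        by (intro tendsto_intros)
      then show ?case by simp
    qed
    show "AE x in lborel. norm ((cmod (f n x - g x))\<^sup>2) \<le> 4 * (cmod (w x))\<^sup>2" for n
      using lim
    proof eventually_elim
      case (elim x)
      have "cmod (g x) \<le> cmod (w x)"
        using le by (intro LIMSEQ_le_const2[OF tendsto_norm[OF elim]]) auto
      then have "cmod (f n x - g x) \<le> 2 * cmod (w x)"
        using le[of n x] norm_triangle_ineq4[of "f n x" "g x"] by linarith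
      then have "(cmod (f n x - g x))\<^sup>2 \<le> (2 * cmod (w x))\<^sup>2"
        by (intro power_mono) auto
      then show ?case by (simp add: power_mult_distrib)
    qed
  qed measurable
  then have "(\<lambda>n. sqrt (\<integral>x. (cmod (f n x - g x))\<^sup>2 \<partial>lborel)) \<longlonglongrightarrow> sqrt 0"
    by (intro tendsto_real_sqrt) simp
  then show ?thesis by (simp add: L2_norm_def)
qed

lemma ennreal_le_suminf: "f k \<le> (\<Sum>k. f k)" for f :: "nat \<Rightarrow> ennreal"
  using sum_le_suminf[of f "{k}"] by simp

text \<open>Riesz-Fischer: a rapidly Cauchy subsequence converges almost everywhere,
  \<open>L2_Fatou\<close> upgrades this to convergence in norm, and the Cauchy property extends it
  to the whole sequence. It supplies the witness behind the choice in
  \<open>fourier\<close>.\<close>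

proposition L2_complete:
  fixes f :: "nat \<Rightarrow> 'a::euclidean_space \<Rightarrow> complex"
  assumes f: "\<And>n. f n \<in> L2_space"
    and Cauchy: "\<And>e. e > 0 \<Longrightarrow> \<exists>N. \<forall>m\<ge>N. \<forall>n\<ge>N. L2_norm (\<lambda>x. f m x - f n x) \<le> e"
  obtains g where "g \<in> L2_space" "(\<lambda>n. L2_norm (\<lambda>x. f n x - g x)) \<longlonglongrightarrow> 0"
proof -
  note [measurable] = L2_spaceD(1)[OF f]
  have "\<exists>N. \<forall>k. (\<forall>n\<ge>N k. L2_norm (\<lambda>x. f n x - f (N k) x) \<le> (1/2)^k) \<and> N k < N (Suc k)"
  proof (rule dependent_nat_choice)
    show "\<exists>N. \<forall>n\<ge>N. L2_norm (\<lambda>x. f n x - f N x) \<le> (1/2)^0"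
      using Cauchy[of 1] by auto
    fix N k
    obtain N' where "\<forall>m\<ge>N'. \<forall>n\<ge>N'. L2_norm (\<lambda>x. f m x - f n x) \<le> (1/2)^Suc k"
      using Cauchy[of "(1/2)^Suc k"] by auto
    then show "\<exists>N'. (\<forall>n\<ge>N'. L2_norm (\<lambda>x. f n x - f N' x) \<le> (1/2)^Suc k) \<and> N < N'"
      by (intro exI[of _ "max N' (Suc N)"]) auto
  qed
  then obtain s where s: "\<And>k n. n \<ge> s k \<Longrightarrow> L2_norm (\<lambda>x. f n x - f (s k) x) \<le> (1/2)^k"
    and mono: "\<And>k. s k < s (Suc k)" by blast
  have sm: "strict_mono s" using mono by (simp add: strict_mono_Suc_iff)
  define d where "d = (\<lambda>k x. f (s (Suc k)) x - f (s k) x)"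
  have d: "L2_norm (d k) \<le> (1/2)^k" for k
    using s[of k "s (Suc k)"] mono[of k] by (simp add: d_def)
  have dL: "d k \<in> L2_space" for k
    unfolding d_def by (intro L2_space_diff f)
  note [measurable] = L2_spaceD(1)[OF dL]
  \<comment> \<open>The weight 2^k is absorbed by the integrals of |d k|^2, which are at most
    4^(-k). Where the weighted sum has a finite value S, it forces |d k x| <= sqrt S * 2^(-k/2), a
    summable bound, so no infinite triangle inequality in L2 is needed.\<close>
  have "(\<integral>\<^sup>+x. (\<Sum>k. ennreal (2^k * (cmod (d k x))\<^sup>2)) \<partial>lborel)
      = (\<Sum>k. \<integral>\<^sup>+x. ennreal (2^k * (cmod (d k x))\<^sup>2) \<partial>lborel)"
    by (rule nn_integral_suminf) measurable
  also have "\<dots> \<le> (\<Sum>k. ennreal ((1/2)^k))"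
  proof (intro suminf_le summableI)
    fix k :: nat
    have "(\<integral>\<^sup>+x. ennreal (2^k * (cmod (d k x))\<^sup>2) \<partial>lborel) = ennreal (2^k) * ennreal ((L2_norm (d k))\<^sup>2)"
      by (simp add: ennreal_mult nn_integral_cmult nn_integral_L2[OF dL])
    also have "\<dots> \<le> ennreal (2^k) * ennreal (((1/2)^k)\<^sup>2)"
      using d[of k] by (intro mult_left_mono ennreal_leI power_mono) auto
    also have "\<dots> = ennreal ((1/2)^k)"
      by (simp flip: ennreal_mult add: power2_eq_square power_divide)
    finally show "(\<integral>\<^sup>+x. ennreal (2^k * (cmod (d k x))\<^sup>2) \<partial>lborel) \<le> ennreal ((1/2)^k)" .
  qed
  also have "\<dots> = ennreal (\<Sum>k. (1/2)^k)"
    by (intro suminf_ennreal2 summable_geometric) auto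
  also have "\<dots> < \<infinity>" by simp
  finally have fin: "AE x in lborel. (\<Sum>k. ennreal (2^k * (cmod (d k x))\<^sup>2)) \<noteq> \<infinity>"
    by (intro nn_integral_PInf_AE) auto
  have conv: "AE x in lborel. convergent (\<lambda>k. f (s k) x)"
    using fin
  proof eventually_elim
    case (elim x)
    define T where "T = (\<Sum>k. ennreal (2^k * (cmod (d k x))\<^sup>2))"
    have "T \<noteq> \<infinity>" using elim unfolding T_def .
    then obtain S where S: "T = ennreal S" "S \<ge> 0"
      by (cases T) auto
    have le: "cmod (d k x) \<le> sqrt S * (sqrt (1/2))^k" for k
    proof -
      have "ennreal (2^k * (cmod (d k x))\<^sup>2) \<le> T"
        unfolding T_def by (rule ennreal_le_suminf)
      then have "2^k * (cmod (d k x))\<^sup>2 \<le> S" using S by simp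
      then have "(cmod (d k x))\<^sup>2 \<le> S * (1/2)^k"
        by (simp add: field_simps power_divide)
      then have "cmod (d k x) \<le> sqrt (S * (1/2)^k)"
        by (rule real_le_rsqrt)
      then show ?thesis by (simp add: real_sqrt_mult real_sqrt_power)
    qed
    have "summable (\<lambda>k. d k x)"
    proof (rule summable_comparison_test'[of "\<lambda>k. sqrt S * (sqrt (1/2))^k" 0])
      have "sqrt (1/2) < sqrt 1" by (rule real_sqrt_less_mono) simp
      then show "summable (\<lambda>k. sqrt S * sqrt (1/2) ^ k)"
        by (intro summable_mult summable_geometric) auto
    qed (use le in auto)
    then have "convergent (\<lambda>n. \<Sum>k<n. d k x)"
      by (simp add: summable_iff_convergent)
    moreover have "(\<Sum>k<n. d k x) = f (s n) x - f (s 0) x" for n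
      using sum_lessThan_telescope[of "\<lambda>k. f (s k) x" n] by (simp add: d_def)
    ultimately have "convergent (\<lambda>n. (f (s n) x - f (s 0) x) + f (s 0) x)"
      by (intro convergent_add convergent_const) simp
    then show ?case by simp
  qed
  \<comment> \<open>Where the subsequence diverges \<open>lim\<close> has an unspecified value; this
    happens only on a null set and does not harm measurability.\<close>
  define g where "g x = lim (\<lambda>k. f (s k) x)" for x
  have [measurable]: "g \<in> borel_measurable borel"
    unfolding g_def by measurable
  have lim: "AE x in lborel. (\<lambda>k. f (s k) x) \<longlonglongrightarrow> g x"
    using conv by eventually_elim (simp add: g_def convergent_LIMSEQ_iff)
  have C': "\<exists>N. \<forall>m\<ge>N. \<forall>n\<ge>N. L2_norm (\<lambda>x. f (s m) x - f (s n) x) \<le> e" if "e > 0" for e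
    using Cauchy[OF that] seq_suble[OF sm] by (meson order_trans)
  note g = L2_Fatou[of "\<lambda>k. f (s k)", OF f _ lim C', simplified]
  have "(\<lambda>n. L2_norm (\<lambda>x. f n x - g x)) \<longlonglongrightarrow> 0"
  proof (rule LIMSEQ_I)
    fix e :: real assume e: "e > 0"
    then obtain N where N: "\<And>m n. m \<ge> N \<Longrightarrow> n \<ge> N \<Longrightarrow> L2_norm (\<lambda>x. f m x - f n x) \<le> e/2"
      using Cauchy[of "e/2"] by auto
    obtain K where K: "\<And>k. k \<ge> K \<Longrightarrow> L2_norm (\<lambda>x. f (s k) x - g x) < e/2"
      using LIMSEQ_D[OF g(2), of "e/2"] e by auto
    have "L2_norm (\<lambda>x. f n x - g x) < e" if "n \<ge> N" for n
    proof -
      let ?k = "max K N"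
      have "L2_norm (\<lambda>x. f n x - g x) \<le> L2_norm (\<lambda>x. f n x - f (s ?k) x) + L2_norm (\<lambda>x. f (s ?k) x - g x)"
        by (intro L2_norm_triangle_diff f g)
      moreover have "L2_norm (\<lambda>x. f n x - f (s ?k) x) \<le> e/2"
        using seq_suble[OF sm, of ?k] that by (intro N) linarith+
      ultimately show ?thesis using K[of ?k] by simp
    qed
    then show "\<exists>N. \<forall>n\<ge>N. norm (L2_norm (\<lambda>x. f n x - g x) - 0) < e"
      by (intro exI[of _ N]) auto
  qed
  with g(1) show ?thesis by (rule that)
qed

section \<open>Fourier integrals and Gaussians\<close>

lemma cnj_measurable [measurable]: "cnj \<in> borel_measurable borel"
  by (intro borel_measurable_continuous_onI continuous_intros)

lemma integrable_exp_mult: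
  fixes u :: "'a::euclidean_space \<Rightarrow> complex"
  assumes "integrable lborel u"
  shows "integrable lborel (\<lambda>X. exp (- \<i> * complex_of_real (X \<bullet> \<Xi>)) * u X)"
proof (rule Bochner_Integration.integrable_bound[OF assms])
  note [measurable] = borel_measurable_integrable[OF assms]
  show "(\<lambda>X. exp (- \<i> * complex_of_real (X \<bullet> \<Xi>)) * u X) \<in> borel_measurable lborel"
    by measurable
qed (simp add: norm_mult)

lemma fourier_integral_measurable [measurable]:
  fixes u :: "'a::euclidean_space \<Rightarrow> complex"
  assumes [measurable]: "u \<in> borel_measurable borel"
  shows "fourier_integral u \<in> borel_measurable borel"
  unfolding fourier_integral_def by measurable

lemma fourier_integral_diff:
  fixes u v :: "'a::euclidean_space \<Rightarrow> complex"
  assumes "integrable lborel u" "integrable lborel v"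
  shows "fourier_integral (\<lambda>x. u x - v x) \<Xi> = fourier_integral u \<Xi> - fourier_integral v \<Xi>"
  unfolding fourier_integral_def right_diff_distrib
  by (intro Bochner_Integration.integral_diff integrable_exp_mult assms)

lemma cmod_fourier_integral_le:
  fixes u :: "'a::euclidean_space \<Rightarrow> complex"
  shows "cmod (fourier_integral u \<Xi>) \<le> (\<integral>x. cmod (u x) \<partial>lborel)"
  unfolding fourier_integral_def
  by (rule order_trans[OF integral_norm_bound]) (simp add: norm_mult)

lemma integrable_bounded_mult:
  fixes u v :: "'a::euclidean_space \<Rightarrow> complex"
  assumes u: "integrable lborel u" and [measurable]: "v \<in> borel_measurable borel"
    and v: "\<And>x. cmod (v x) \<le> B"
  shows "integrable lborel (\<lambda>x. u x * v x)"
proof (rule Bochner_Integration.integrable_bound)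
  show "integrable lborel (\<lambda>x. complex_of_real B * u x)" using u by simp
  note [measurable] = borel_measurable_integrable[OF u]
  show "(\<lambda>x. u x * v x) \<in> borel_measurable lborel" by measurable
  have "cmod (v x) \<le> \<bar>B\<bar>" for x using v[of x] by simp
  then show "AE x in lborel. norm (u x * v x) \<le> norm (complex_of_real B * u x)"
    by (intro AE_I2) (simp add: norm_mult mult.commute[of "cmod (u _)"] mult_right_mono)
qed

text \<open>Both sides are iterated integrals of one kernel, exchanged by Fubini; the exponential
  has modulus 1, so absolute integrability reduces to that of \<open>u\<close> and \<open>v\<close>.
  Isometry and surjectivity both rest on this identity.\<close>

lemma fourier_integral_mult_formula:
  fixes u v :: "'a::euclidean_space \<Rightarrow> complex"
  assumes u: "integrable lborel u" and v: "integrable lborel v"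
  shows "(\<integral>\<xi>. fourier_integral u \<xi> * v \<xi> \<partial>lborel) = (\<integral>x. u x * fourier_integral v x \<partial>lborel)"
proof -
  note [measurable] = borel_measurable_integrable[OF u] borel_measurable_integrable[OF v]
  let ?f = "\<lambda>(\<xi>, x). exp (- \<i> * complex_of_real (x \<bullet> \<xi>)) * u x * v \<xi>"
  have "integrable (lborel \<Otimes>\<^sub>M lborel) ?f"
  proof (rule lborel_pair.Fubini_integrable)
    show "?f \<in> borel_measurable (lborel \<Otimes>\<^sub>M lborel)" by measurable
    show "integrable lborel (\<lambda>\<xi>. \<integral>x. norm (?f (\<xi>, x)) \<partial>lborel)"
      using v by (simp add: norm_mult)
    show "AE \<xi> in lborel. integrable lborel (\<lambda>x. ?f (\<xi>, x))"
      using integrable_exp_mult[OF u] by (intro AE_I2) simp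
  qed
  from lborel_pair.Fubini_integral[OF this]
  have "(\<integral>\<xi>. (\<integral>x. exp (- \<i> * complex_of_real (x \<bullet> \<xi>)) * u x * v \<xi> \<partial>lborel) \<partial>lborel)
      = (\<integral>x. (\<integral>\<xi>. exp (- \<i> * complex_of_real (x \<bullet> \<xi>)) * u x * v \<xi> \<partial>lborel) \<partial>lborel)"
    by simp
  moreover have "(\<integral>\<xi>. exp (- \<i> * complex_of_real (x \<bullet> \<xi>)) * u x * v \<xi> \<partial>lborel)
      = u x * fourier_integral v x" for x
    unfolding fourier_integral_def integral_mult_right_zero[symmetric] by (simp add: mult_ac inner_commute)
  ultimately show ?thesis by (simp add: fourier_integral_def)
qed

section \<open>Changes of variables and Gaussian integrals\<close>

lemma integral_lborel_affine:
  fixes f :: "'a::euclidean_space \<Rightarrow> complex"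
  assumes [measurable]: "f \<in> borel_measurable borel" and "c \<noteq> 0"
  shows "(\<integral>x. f x \<partial>lborel) = complex_of_real (\<bar>c\<bar> ^ DIM('a)) * (\<integral>x. f (t + c *\<^sub>R x) \<partial>lborel)"
  by (subst lborel_affine[OF \<open>c \<noteq> 0\<close>, of t])
     (simp add: integral_density integral_distr scaleR_conv_of_real)

lemma nn_integral_lborel_affine:
  fixes f :: "'a::euclidean_space \<Rightarrow> ennreal"
  assumes [measurable]: "f \<in> borel_measurable borel" and "c \<noteq> 0"
  shows "(\<integral>\<^sup>+x. f x \<partial>lborel) = ennreal (\<bar>c\<bar> ^ DIM('a)) * (\<integral>\<^sup>+x. f (t + c *\<^sub>R x) \<partial>lborel)"
  by (subst lborel_affine[OF \<open>c \<noteq> 0\<close>, of t])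
     (simp add: nn_integral_density nn_integral_distr nn_integral_cmult)

lemma integrable_lborel_affine:
  fixes f :: "'a::euclidean_space \<Rightarrow> complex"
  assumes f: "integrable lborel f" and "c \<noteq> 0"
  shows "integrable lborel (\<lambda>x. f (t + c *\<^sub>R x))"
proof -
  note [measurable] = borel_measurable_integrable[OF f]
  have "(\<integral>\<^sup>+x. ennreal (cmod (f x)) \<partial>lborel) < \<infinity>"
    using f by (simp add: integrable_iff_bounded)
  then have "ennreal (\<bar>c\<bar> ^ DIM('a)) * (\<integral>\<^sup>+x. ennreal (cmod (f (t + c *\<^sub>R x))) \<partial>lborel) < \<infinity>"
    using nn_integral_lborel_affine[of "\<lambda>x. ennreal (cmod (f x))" c t] \<open>c \<noteq> 0\<close> by simp
  then have "(\<integral>\<^sup>+x. ennreal (cmod (f (t + c *\<^sub>R x))) \<partial>lborel) < \<infinity>"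
    using \<open>c \<noteq> 0\<close> by (auto simp: ennreal_mult_less_top less_top)
  then show ?thesis by (simp add: integrable_iff_bounded)
qed

text \<open>Lebesgue measure is the image of a product of one-dimensional Lebesgue measures under
  the coordinate sum. This reduces the transform of a Gaussian to one variable.\<close>

lemma
  fixes f :: "'a::euclidean_space \<Rightarrow> real \<Rightarrow> complex"
  assumes f: "\<And>b. b \<in> Basis \<Longrightarrow> integrable lborel (f b)"
  shows integrable_lborel_prod: "integrable lborel (\<lambda>x::'a. \<Prod>b\<in>Basis. f b (x \<bullet> b))"
    and integral_lborel_prod:
      "(\<integral>x. (\<Prod>b\<in>Basis. f b (x \<bullet> b)) \<partial>(lborel :: 'a measure)) = (\<Prod>b\<in>Basis. (\<integral>x. f b x \<partial>lborel))"
proof -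
  interpret product_sigma_finite "\<lambda>_::'a. lborel :: real measure" ..
  have [measurable]: "f b \<in> borel_measurable borel" if "b \<in> Basis" for b
    using borel_measurable_integrable[OF f[OF that]] by simp
  have eq: "(\<Prod>b\<in>Basis. f b ((\<Sum>i\<in>Basis. x i *\<^sub>R i) \<bullet> b)) = (\<Prod>b\<in>Basis. f b (x b))" for x :: "'a \<Rightarrow> real"
    by (rule prod.cong) auto
  show "integrable lborel (\<lambda>x::'a. \<Prod>b\<in>Basis. f b (x \<bullet> b))"
    by (subst lborel_eq, subst integrable_distr_eq) (auto simp: eq intro!: product_integrable_prod f)
  show "(\<integral>x. (\<Prod>b\<in>Basis. f b (x \<bullet> b)) \<partial>(lborel :: 'a measure)) = (\<Prod>b\<in>Basis. (\<integral>x. f b x \<partial>lborel))"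
    by (subst lborel_eq, subst integral_distr) (auto simp: eq product_integral_prod f)
qed

text \<open>For e = 1 this is the characteristic function of the standard normal distribution, up to
  the factor sqrt (2 pi) that normalises its density; a dilation by e gives the rest.\<close>

lemma
  fixes e t :: real
  assumes e: "e > 0"
  shows integrable_gauss_real:
      "integrable lborel (\<lambda>x. exp (- \<i> * complex_of_real (x * t)) * complex_of_real (exp (- (e\<^sup>2 * x\<^sup>2) / 2)))"
    and integral_gauss_real:
      "(\<integral>x. exp (- \<i> * complex_of_real (x * t)) * complex_of_real (exp (- (e\<^sup>2 * x\<^sup>2) / 2)) \<partial>lborel)
        = complex_of_real (sqrt (2 * pi) / e * exp (- (t\<^sup>2 / e\<^sup>2) / 2))"
proof -
  define G where "G s x = exp (- \<i> * complex_of_real (x * s)) * complex_of_real (exp (- x\<^sup>2 / 2))" for s x :: real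
  have [measurable]: "G s \<in> borel_measurable borel" for s
    unfolding G_def by measurable
  have G: "G s x = complex_of_real (sqrt (2 * pi)) * (std_normal_density x *\<^sub>R iexp ((- s) * x))" for s x
    by (simp add: G_def std_normal_density_def scaleR_conv_of_real mult_ac real_sqrt_mult flip: of_real_mult)
  have "integrable lborel (\<lambda>x. std_normal_density x *\<^sub>R iexp (s * x))" for s
  proof (rule Bochner_Integration.integrable_bound)
    show "integrable lborel std_normal_density" by simp
  qed (auto simp: normal_density_nonneg)
  then have Gi: "integrable lborel (G s)" for s
    unfolding G[abs_def] by (intro integrable_mult_right)
  have "(\<integral>x. std_normal_density x *\<^sub>R iexp (s * x) \<partial>lborel) = char std_normal_distribution s" for s
    unfolding char_def by (subst integral_density) (auto simp: normal_density_nonneg)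
  note this[of "- s" for s]
  then have GI: "(\<integral>x. G s x \<partial>lborel) = complex_of_real (sqrt (2 * pi) * exp (- s\<^sup>2 / 2))" for s
    unfolding G integral_mult_right_zero char_std_normal_distribution by simp
  have eq: "exp (- \<i> * complex_of_real (x * t)) * complex_of_real (exp (- (e\<^sup>2 * x\<^sup>2) / 2)) = G (t / e) (0 + e * x)" for x
    using e by (simp add: G_def power_mult_distrib)
  show "integrable lborel (\<lambda>x. exp (- \<i> * complex_of_real (x * t)) * complex_of_real (exp (- (e\<^sup>2 * x\<^sup>2) / 2)))"
    unfolding eq using e by (intro lborel_integrable_real_affine Gi) auto
  have "complex_of_real (sqrt (2 * pi) * exp (- (t / e)\<^sup>2 / 2)) = e *\<^sub>R (\<integral>x. G (t / e) (0 + e * x) \<partial>lborel)"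
    using lborel_integral_real_affine[of e "G (t/e)" 0] e by (simp only: GI) simp
  then show "(\<integral>x. exp (- \<i> * complex_of_real (x * t)) * complex_of_real (exp (- (e\<^sup>2 * x\<^sup>2) / 2)) \<partial>lborel)
        = complex_of_real (sqrt (2 * pi) / e * exp (- (t\<^sup>2 / e\<^sup>2) / 2))"
    unfolding eq using e by (simp add: scaleR_conv_of_real field_simps power_divide)
qed

text \<open>The parameter is an inverse width: \<open>gauss e\<close> increases to 1 as e decreases
  to 0, while its transform is a multiple of \<open>gauss (1 / e)\<close> and acts as an approximate
  identity.\<close>

definition gauss :: "real \<Rightarrow> 'a::euclidean_space \<Rightarrow> real" where
  "gauss e x = exp (- (e\<^sup>2 * (norm x)\<^sup>2) / 2)"

lemma gauss_measurable [measurable]: "gauss e \<in> borel_measurable borel"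
  unfolding gauss_def by measurable

lemma gauss_nonneg [simp]: "0 \<le> gauss e x"
  by (simp add: gauss_def)

lemma gauss_prod: "gauss e x = (\<Prod>b\<in>Basis. exp (- (e\<^sup>2 * (x \<bullet> b)\<^sup>2) / 2))"
proof -
  have "(norm x)\<^sup>2 = (\<Sum>b\<in>Basis. (x \<bullet> b)\<^sup>2)"
    unfolding power2_norm_eq_inner by (subst euclidean_inner) (simp add: power2_eq_square)
  then show ?thesis
    by (simp add: gauss_def exp_sum[symmetric] sum_distrib_left sum_negf sum_divide_distrib)
qed

lemma
  fixes \<xi> :: "'a::euclidean_space"
  assumes e: "e > 0"
  shows integrable_exp_gauss:
      "integrable lborel (\<lambda>x. exp (- \<i> * complex_of_real (x \<bullet> \<xi>)) * complex_of_real (gauss e x))"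
    and fourier_integral_gauss: "fourier_integral (\<lambda>x. complex_of_real (gauss e x)) \<xi>
        = complex_of_real ((sqrt (2 * pi) / e) ^ DIM('a) * gauss (1 / e) \<xi>)"
proof -
  have eq: "exp (- \<i> * complex_of_real (x \<bullet> \<xi>)) * complex_of_real (gauss e x)
    = (\<Prod>b\<in>Basis. exp (- \<i> * complex_of_real ((x \<bullet> b) * (\<xi> \<bullet> b)))
        * complex_of_real (exp (- (e\<^sup>2 * (x \<bullet> b)\<^sup>2) / 2)))" for x
  proof -
    have "exp (- \<i> * complex_of_real (x \<bullet> \<xi>)) = exp (\<Sum>b\<in>Basis. - \<i> * complex_of_real ((x \<bullet> b) * (\<xi> \<bullet> b)))"
      by (subst euclidean_inner) (simp add: sum_distrib_left)
    also have "\<dots> = (\<Prod>b\<in>Basis. exp (- \<i> * complex_of_real ((x \<bullet> b) * (\<xi> \<bullet> b))))"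
      by (rule exp_sum) simp
    finally show ?thesis by (simp add: gauss_prod prod.distrib)
  qed
  show "integrable lborel (\<lambda>x. exp (- \<i> * complex_of_real (x \<bullet> \<xi>)) * complex_of_real (gauss e x))"
    unfolding eq by (rule integrable_lborel_prod) (rule integrable_gauss_real[OF e])
  show "fourier_integral (\<lambda>x. complex_of_real (gauss e x)) \<xi>
        = complex_of_real ((sqrt (2 * pi) / e) ^ DIM('a) * gauss (1 / e) \<xi>)"
    unfolding fourier_integral_def eq integral_lborel_prod[OF integrable_gauss_real[OF e]]
      integral_gauss_real[OF e]
    by (simp add: gauss_prod prod.distrib power_divide prod_dividef)
qed

lemma integrable_gauss:
  assumes "e > 0"
  shows "integrable lborel (gauss e :: 'a::euclidean_space \<Rightarrow> real)"
  using integrable_norm[OF integrable_exp_gauss[OF assms, of "0::'a"]] by simp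

lemma integral_gauss_1: "(\<integral>x. gauss 1 x \<partial>(lborel :: 'a::euclidean_space measure)) = sqrt (2 * pi) ^ DIM('a)"
proof -
  have "complex_of_real (\<integral>x. gauss 1 x \<partial>(lborel :: 'a measure)) = fourier_integral (\<lambda>x. complex_of_real (gauss 1 x)) (0::'a)"
    by (simp add: fourier_integral_def)
  also have "\<dots> = complex_of_real (sqrt (2 * pi) ^ DIM('a))"
    by (simp add: fourier_integral_gauss) (simp add: gauss_def)
  finally show ?thesis by (simp only: of_real_eq_iff)
qed

text \<open>The Gaussian weight makes the energy of the transform finite before square integrability
  is known. The conjugate of the transform of \<open>f\<close> is the transform of the reflected
  conjugate \<open>k\<close>, so the multiplication formula moves the weight to the other side,
  where it becomes a Gaussian average of \<open>f\<close> at scale e.\<close>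

lemma gauss_weighted_fourier_integral:
  fixes f :: "'a::euclidean_space \<Rightarrow> complex"
  assumes f: "integrable lborel f" and e: "e > 0"
  shows "(\<integral>\<xi>. gauss e \<xi> * (cmod (fourier_integral f \<xi>))\<^sup>2 \<partial>lborel)
    = complex_of_real (sqrt (2 * pi) ^ DIM('a))
        * (\<integral>x. f x * (\<integral>z. complex_of_real (gauss 1 z) * cnj (f (x - e *\<^sub>R z)) \<partial>lborel) \<partial>lborel)"
proof -
  note [measurable] = borel_measurable_integrable[OF f]
  define k where "k = (\<lambda>y. cnj (f (- y)))"
  have k: "integrable lborel k"
    using integrable_lborel_affine[OF f, of "-1" 0] by (simp add: k_def)
  note [measurable] = borel_measurable_integrable[OF k]
  have Fk: "fourier_integral k \<xi> = cnj (fourier_integral f \<xi>)" for \<xi>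
  proof -
    have "cnj (fourier_integral f \<xi>) = (\<integral>x. cnj (exp (- \<i> * complex_of_real (x \<bullet> \<xi>)) * f x) \<partial>lborel)"
      unfolding fourier_integral_def by (rule Bochner_Integration.integral_cnj[symmetric])
    also have "\<dots> = (\<integral>x. exp (\<i> * complex_of_real (x \<bullet> \<xi>)) * cnj (f x) \<partial>lborel)"
      by (simp add: exp_cnj)
    also have "\<dots> = (\<integral>x. exp (\<i> * complex_of_real ((0 + (-1) *\<^sub>R x) \<bullet> \<xi>)) * cnj (f (0 + (-1) *\<^sub>R x)) \<partial>lborel)"
      by (subst integral_lborel_affine[of _ "-1" 0]) simp_all
    finally show ?thesis by (simp add: fourier_integral_def k_def)
  qed
  \<comment> \<open>This is integrable, since the Gaussian is and the transform of an integrable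
    function is bounded; hence the multiplication formula applies both to \<open>k\<close> and the
    modulated Gaussian, and to \<open>f\<close> and \<open>h\<close>.\<close>
  define h where "h = (\<lambda>\<xi>. complex_of_real (gauss e \<xi>) * fourier_integral k \<xi>)"
  have h: "integrable lborel h"
    unfolding h_def using integrable_gauss[OF e, where 'a='a]
    by (intro integrable_bounded_mult[OF _ _ cmod_fourier_integral_le] integrable_of_real
        fourier_integral_measurable) simp_all
  have Fh: "fourier_integral h x = complex_of_real (sqrt (2 * pi) ^ DIM('a))
      * (\<integral>z. complex_of_real (gauss 1 z) * cnj (f (x - e *\<^sub>R z)) \<partial>lborel)" for x
  proof -
    let ?g = "\<lambda>\<xi>. exp (- \<i> * complex_of_real (\<xi> \<bullet> x)) * complex_of_real (gauss e \<xi>)"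
    have Fg: "fourier_integral ?g y = complex_of_real ((sqrt (2 * pi) / e) ^ DIM('a) * gauss (1 / e) (x + y))" for y
    proof -
      have "fourier_integral ?g y = fourier_integral (\<lambda>x. complex_of_real (gauss e x)) (x + y)"
      proof -
        have "exp (- \<i> * complex_of_real (X \<bullet> (x + y)))
            = exp (- \<i> * complex_of_real (X \<bullet> y)) * exp (- \<i> * complex_of_real (X \<bullet> x))" for X
          by (simp add: inner_add_right algebra_simps flip: exp_add)
        then show ?thesis
          unfolding fourier_integral_def by (simp only: mult.assoc)
      qed
      then show ?thesis by (simp only: fourier_integral_gauss[OF e])
    qed
    have "fourier_integral h x = (\<integral>\<xi>. fourier_integral k \<xi> * ?g \<xi> \<partial>lborel)"
      unfolding fourier_integral_def[of h] unfolding h_def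
      by (intro Bochner_Integration.integral_cong refl) (simp only: mult_ac)
    also have "\<dots> = (\<integral>y. k y * fourier_integral ?g y \<partial>lborel)"
      by (rule fourier_integral_mult_formula[OF k integrable_exp_gauss[OF e, of x]])
    also have "\<dots> = (\<integral>y. k y * complex_of_real ((sqrt (2 * pi) / e) ^ DIM('a) * gauss (1 / e) (x + y)) \<partial>lborel)"
      by (simp only: Fg)
    \<comment> \<open>Substituting y = - x + e z centres the Gaussian, and the Jacobian cancels the
      powers of e in the constant of its transform.\<close>
    also have "\<dots> = complex_of_real (\<bar>e\<bar> ^ DIM('a)) * (\<integral>z. k (- x + e *\<^sub>R z)
        * complex_of_real ((sqrt (2 * pi) / e) ^ DIM('a) * gauss (1 / e) (x + (- x + e *\<^sub>R z))) \<partial>lborel)"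
      using e by (subst integral_lborel_affine[of _ e "- x"]) simp_all
    also have "\<dots> = complex_of_real (\<bar>e\<bar> ^ DIM('a)) * (\<integral>z. complex_of_real ((sqrt (2 * pi) / e) ^ DIM('a))
        * (complex_of_real (gauss 1 z) * cnj (f (x - e *\<^sub>R z))) \<partial>lborel)"
    proof -
      have "gauss (1 / e) (x + (- x + e *\<^sub>R z)) = gauss 1 z" for z
        using e by (simp add: gauss_def power_divide power_mult_distrib)
      then show ?thesis by (simp add: k_def mult_ac)
    qed
    also have "\<dots> = complex_of_real (\<bar>e\<bar> ^ DIM('a) * (sqrt (2 * pi) / e) ^ DIM('a))
        * (\<integral>z. complex_of_real (gauss 1 z) * cnj (f (x - e *\<^sub>R z)) \<partial>lborel)"
      by (subst integral_mult_right_zero) (simp only: of_real_mult mult.assoc)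
    also have "\<bar>e\<bar> ^ DIM('a) * (sqrt (2 * pi) / e) ^ DIM('a) = sqrt (2 * pi) ^ DIM('a)"
      using e by (simp add: power_divide)
    finally show ?thesis .
  qed
  have "complex_of_real (\<integral>\<xi>. gauss e \<xi> * (cmod (fourier_integral f \<xi>))\<^sup>2 \<partial>lborel)
      = (\<integral>\<xi>. fourier_integral f \<xi> * h \<xi> \<partial>lborel)"
    unfolding h_def Fk integral_complex_of_real[symmetric]
    by (intro Bochner_Integration.integral_cong refl) (simp add: complex_norm_square mult_ac del: of_real_power)
  also have "\<dots> = (\<integral>x. f x * fourier_integral h x \<partial>lborel)"
    by (rule fourier_integral_mult_formula[OF f h])
  also have "\<dots> = complex_of_real (sqrt (2 * pi) ^ DIM('a))
        * (\<integral>x. f x * (\<integral>z. complex_of_real (gauss 1 z) * cnj (f (x - e *\<^sub>R z)) \<partial>lborel) \<partial>lborel)"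
    by (simp only: Fh mult.left_commute[of "f _"] integral_mult_right_zero)
  finally show ?thesis .
qed

section \<open>Plancherel's theorem\<close>

text \<open>Let e tend to 0 in the weighted identity. Continuity gives convergence of f (x - e z) to
  f x at every point and boundedness a dominating constant, so the right side converges by dominated
  convergence. The left side increases, and monotone convergence yields square integrability
  together with the value of the norm.\<close>

lemma fourier_integral_isometry_continuous:
  fixes f :: "'a::euclidean_space \<Rightarrow> complex"
  assumes cont: "continuous_on UNIV f" and B: "\<And>x. cmod (f x) \<le> B"
    and f: "integrable lborel f" and fL: "f \<in> L2_space"
  shows "fourier_integral f \<in> L2_space"
    and "L2_norm (fourier_integral f) = sqrt (2 * pi) ^ DIM('a) * L2_norm f"
proof -
  note [measurable] = borel_measurable_integrable[OF f]
  define K where "K = sqrt (2 * pi) ^ DIM('a)"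
  define e where "e n = 1 / real (Suc n)" for n
  have e: "e n > 0" for n by (simp add: e_def)
  have e0: "e \<longlonglongrightarrow> 0"
    unfolding e_def by (rule LIMSEQ_Suc[OF lim_1_over_n])
  have B0: "0 \<le> B"
    using B[of 0] norm_ge_zero[of "f 0"] by linarith
  have cf: "isCont f x" for x
    using cont by (simp add: continuous_on_eq_continuous_at)
  define J where "J n x = (\<integral>z. complex_of_real (gauss 1 z) * cnj (f (x - e n *\<^sub>R z)) \<partial>lborel)" for n x
  define I where "I n = (\<integral>\<xi>. gauss (e n) \<xi> * (cmod (fourier_integral f \<xi>))\<^sup>2 \<partial>lborel)" for n
  have gK: "(\<integral>z. complex_of_real (gauss 1 z) * c \<partial>(lborel :: 'a measure)) = complex_of_real K * c" for c
    by (simp add: integral_gauss_1 K_def)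
  have J: "(\<lambda>n. J n x) \<longlonglongrightarrow> complex_of_real K * cnj (f x)" for x
    unfolding J_def gK[symmetric]
  proof (rule integral_dominated_convergence)
    show "integrable lborel (\<lambda>z::'a. gauss 1 z * B)"
      by (intro integrable_mult_left integrable_gauss) simp
    show "AE z in lborel. (\<lambda>n. complex_of_real (gauss 1 z) * cnj (f (x - e n *\<^sub>R z)))
        \<longlonglongrightarrow> complex_of_real (gauss 1 z) * cnj (f x)"
    proof (intro AE_I2 tendsto_intros isCont_tendsto_compose[OF cf])
      fix z
      show "(\<lambda>n. x - e n *\<^sub>R z) \<longlonglongrightarrow> x"
        using tendsto_diff[OF tendsto_const tendsto_scaleR[OF e0 tendsto_const], of x z] by simp
    qed
  qed (use B in \<open>auto simp: norm_mult intro!: mult_left_mono\<close>)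
  have Jle: "cmod (J n x) \<le> K * B" for n x
  proof -
    have "cmod (J n x) \<le> (\<integral>z. norm (complex_of_real (gauss 1 z) * cnj (f (x - e n *\<^sub>R z))) \<partial>lborel)"
      unfolding J_def by (rule integral_norm_bound)
    also have "\<dots> \<le> (\<integral>z. gauss 1 z * B \<partial>(lborel :: 'a measure))"
    proof (rule integral_mono_AE')
      show "integrable lborel (\<lambda>z::'a. gauss 1 z * B)"
        by (intro integrable_mult_left integrable_gauss) simp
    qed (use B B0 in \<open>auto simp: norm_mult intro!: mult_left_mono\<close>)
    also have "\<dots> = K * B" by (simp add: integral_gauss_1 K_def)
    finally show ?thesis .
  qed
  have [measurable]: "J n \<in> borel_measurable borel" for n
    unfolding J_def by measurable
  have "(\<lambda>n. \<integral>x. f x * J n x \<partial>lborel) \<longlonglongrightarrow> (\<integral>x. f x * (complex_of_real K * cnj (f x)) \<partial>lborel)"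
  proof (rule integral_dominated_convergence)
    show "integrable lborel (\<lambda>x. cmod (f x) * (K * B))"
      using f by simp
    show "AE x in lborel. (\<lambda>n. f x * J n x) \<longlonglongrightarrow> f x * (complex_of_real K * cnj (f x))"
      by (intro AE_I2 tendsto_intros J)
    show "AE x in lborel. norm (f x * J n x) \<le> cmod (f x) * (K * B)" for n
      using Jle by (auto simp: norm_mult intro!: mult_left_mono)
  qed measurable
  moreover have "(\<integral>x. f x * (complex_of_real K * cnj (f x)) \<partial>lborel) = complex_of_real (K * (L2_norm f)\<^sup>2)"
  proof -
    have "complex_of_real (K * (L2_norm f)\<^sup>2) = (\<integral>x. complex_of_real (K * (cmod (f x))\<^sup>2) \<partial>lborel)"
      by (simp add: L2_norm_sq del: of_real_power)
    also have "\<dots> = (\<integral>x. f x * (complex_of_real K * cnj (f x)) \<partial>lborel)"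
      by (intro Bochner_Integration.integral_cong refl)
         (simp only: of_real_mult complex_norm_square mult_ac)
    finally show ?thesis by simp
  qed
  ultimately have "(\<lambda>n. complex_of_real K * (\<integral>x. f x * J n x \<partial>lborel))
      \<longlonglongrightarrow> complex_of_real K * complex_of_real (K * (L2_norm f)\<^sup>2)"
    by (intro tendsto_intros) simp
  moreover have "complex_of_real K * (\<integral>x. f x * J n x \<partial>lborel) = complex_of_real (I n)" for n
    unfolding I_def J_def K_def by (rule gauss_weighted_fourier_integral[OF f e, symmetric])
  ultimately have I: "I \<longlonglongrightarrow> (K * L2_norm f)\<^sup>2"
    by (simp only: of_real_mult[symmetric] tendsto_of_real_iff) (simp add: power_mult_distrib power2_eq_square mult_ac)
  have [measurable]: "fourier_integral f \<in> borel_measurable borel"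
    by measurable
  have "(\<lambda>n. \<integral>\<^sup>+\<xi>. ennreal (gauss (e n) \<xi> * (cmod (fourier_integral f \<xi>))\<^sup>2) \<partial>lborel)
      \<longlonglongrightarrow> (\<integral>\<^sup>+\<xi>. ennreal ((cmod (fourier_integral f \<xi>))\<^sup>2) \<partial>lborel)"
  proof (rule nn_integral_LIMSEQ)
    have "gauss (e n) \<xi> \<le> gauss (e (Suc n)) \<xi>" for n and \<xi> :: 'a
    proof -
      have "e (Suc n) \<le> e n" by (simp add: e_def field_simps)
      then have "(e (Suc n))\<^sup>2 \<le> (e n)\<^sup>2"
        using e[of "Suc n"] by (intro power_mono) auto
      then show ?thesis by (simp add: gauss_def mult_right_mono)
    qed
    then show "incseq (\<lambda>n \<xi>. ennreal (gauss (e n) \<xi> * (cmod (fourier_integral f \<xi>))\<^sup>2))"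
      by (intro incseq_SucI le_funI ennreal_leI mult_right_mono) auto
    fix \<xi> :: 'a
    have "(\<lambda>n. gauss (e n) \<xi>) \<longlonglongrightarrow> exp (- (0\<^sup>2 * (norm \<xi>)\<^sup>2) / 2)"
      unfolding gauss_def by (intro tendsto_intros e0) simp
    then have "(\<lambda>n. ennreal (gauss (e n) \<xi> * (cmod (fourier_integral f \<xi>))\<^sup>2))
        \<longlonglongrightarrow> ennreal (exp (- (0\<^sup>2 * (norm \<xi>)\<^sup>2) / 2) * (cmod (fourier_integral f \<xi>))\<^sup>2)"
      by (intro tendsto_intros)
    then show "(\<lambda>n. ennreal (gauss (e n) \<xi> * (cmod (fourier_integral f \<xi>))\<^sup>2))
        \<longlonglongrightarrow> ennreal ((cmod (fourier_integral f \<xi>))\<^sup>2)" by simp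
  qed measurable
  moreover have "(\<integral>\<^sup>+\<xi>. ennreal (gauss (e n) \<xi> * (cmod (fourier_integral f \<xi>))\<^sup>2) \<partial>lborel) = ennreal (I n)" for n
    unfolding I_def
  proof (rule nn_integral_eq_integral)
    show "integrable lborel (\<lambda>\<xi>. gauss (e n) \<xi> * (cmod (fourier_integral f \<xi>))\<^sup>2)"
    proof (rule Bochner_Integration.integrable_bound)
      show "integrable lborel (\<lambda>\<xi>::'a. gauss (e n) \<xi> * (\<integral>x. cmod (f x) \<partial>lborel)\<^sup>2)"
        by (intro integrable_mult_left integrable_gauss e)
      show "AE \<xi> in lborel. norm (gauss (e n) \<xi> * (cmod (fourier_integral f \<xi>))\<^sup>2)
          \<le> norm (gauss (e n) \<xi> * (\<integral>x. cmod (f x) \<partial>lborel)\<^sup>2)"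
        by (auto simp: abs_mult intro!: mult_left_mono power_mono cmod_fourier_integral_le)
    qed measurable
  qed auto
  ultimately have lim: "(\<lambda>n. ennreal (I n)) \<longlonglongrightarrow> (\<integral>\<^sup>+\<xi>. ennreal ((cmod (fourier_integral f \<xi>))\<^sup>2) \<partial>lborel)"
    by simp
  have nn: "(\<integral>\<^sup>+\<xi>. ennreal ((cmod (fourier_integral f \<xi>))\<^sup>2) \<partial>lborel) = ennreal ((K * L2_norm f)\<^sup>2)"
    by (rule LIMSEQ_unique[OF lim]) (intro tendsto_intros I)
  have K: "0 \<le> K" by (simp add: K_def)
  show L: "fourier_integral f \<in> L2_space"
    by (rule L2_spaceI_nn) (auto simp: nn)
  have "(L2_norm (fourier_integral f))\<^sup>2 = (K * L2_norm f)\<^sup>2"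
    using nn unfolding nn_integral_L2[OF L] by (simp add: power_mult_distrib)
  then show "L2_norm (fourier_integral f) = sqrt (2 * pi) ^ DIM('a) * L2_norm f"
    using K by (simp add: power2_eq_iff_nonneg K_def)
qed

text \<open>Closeness in L1 and in L2 is needed at once: the former will give pointwise convergence
  of the transforms, the latter their Cauchy property. Continuous functions converging to
  \<open>f\<close> almost everywhere come without any bound, so they are truncated in value and in
  space by continuous maps.\<close>

lemma continuous_approx:
  fixes f :: "'a::euclidean_space \<Rightarrow> complex"
  assumes f: "integrable lborel f" and fL: "f \<in> L2_space" and d: "d > 0"
  obtains h B where "continuous_on UNIV h" "\<And>x. cmod (h x) \<le> B" "integrable lborel h" "h \<in> L2_space"
    "(\<integral>x. cmod (h x - f x) \<partial>lborel) < d" "L2_norm (\<lambda>x. h x - f x) < d"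
proof -
  note [measurable] = borel_measurable_integrable[OF f]
  \<comment> \<open>\<open>measurable_on\<close> provides continuous functions converging to
    \<open>f\<close> off a negligible set; negligibility refers to \<open>lebesgue\<close> and is
    then carried over to \<open>lborel\<close>.\<close>
  have "f measurable_on UNIV"
    using borel_measurable_integrable[OF f]
    by (intro lebesgue_measurable_imp_measurable_on) (auto intro: measurable_completion)
  then obtain N g where N: "negligible N" and g: "\<And>n. continuous_on UNIV (g n)"
    and lim: "\<And>x. x \<notin> N \<Longrightarrow> (\<lambda>n. g n x) \<longlonglongrightarrow> f x"
    unfolding measurable_on_def by auto
  have AEN: "AE x in lborel. (\<lambda>n. g n x) \<longlonglongrightarrow> f x"
  proof -
    have "AE x in lebesgue. x \<notin> N"
      using N by (intro AE_not_in) (simp add: negligible_iff_null_sets)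
    then have "AE x in lborel. x \<notin> N" by (simp add: AE_completion_iff)
    then show ?thesis by eventually_elim (rule lim)
  qed
  \<comment> \<open>Truncation of values to a disc. Being a nearest point map it is 1-Lipschitz and
    fixes 0, so it is continuous and does not increase the modulus.\<close>
  define P where "P k z = closest_point (cball (0::complex) (real k)) z" for k :: nat and z
  \<comment> \<open>A continuous cutoff: 1 on the ball of radius k, 0 off the ball of radius k +
    1.\<close>
  define \<phi> where "\<phi> k x = max 0 (min 1 (real k + 1 - norm x))" for k :: nat and x :: 'a
  have Pc: "continuous_on UNIV (P k)" for k
    unfolding P_def by (rule continuous_on_closest_point) auto
  have Pk: "cmod (P k z) \<le> real k" for k z
    using closest_point_in_set[of "cball (0::complex) (real k)" z] by (simp add: P_def)
  have Ple: "cmod (P k z) \<le> cmod z" for k z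
  proof -
    have "closest_point (cball (0::complex) (real k)) 0 = 0"
      by (rule closest_point_self) simp
    then show ?thesis
      using closest_point_lipschitz[of "cball (0::complex) (real k)" z 0] by (simp add: P_def)
  qed
  have Pid: "P k z = z" if "cmod z \<le> real k" for k z
    using that by (simp add: P_def closest_point_self)
  have \<phi>01: "0 \<le> \<phi> k x" "\<phi> k x \<le> 1" for k x by (auto simp: \<phi>_def)
  have \<phi>c: "continuous_on UNIV (\<phi> k)" for k
    unfolding \<phi>_def by (intro continuous_intros)
  have \<phi>0: "\<phi> k x \<le> indicator (cball 0 (real k + 1)) x" for k x
    by (auto simp: \<phi>_def indicator_def)
  have [measurable]: "P k \<in> borel_measurable borel" "\<phi> k \<in> borel_measurable borel"
     "g k \<in> borel_measurable borel" for k
    using Pc \<phi>c g by (auto intro: borel_measurable_continuous_onI)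
  define F where "F k x = complex_of_real (\<phi> k x) * P k (f x)" for k x
  have Fle: "cmod (F k x) \<le> cmod (f x)" for k x
    using \<phi>01[of k x] Ple[of k "f x"] mult_mono[of "\<phi> k x" 1 "cmod (P k (f x))" "cmod (f x)"]
    by (simp add: F_def norm_mult)
  have [measurable]: "F k \<in> borel_measurable borel" for k
    unfolding F_def by measurable
  have Flim: "(\<lambda>k. F k x) \<longlonglongrightarrow> f x" for x
  proof (rule tendsto_eventually)
    obtain m :: nat where "max (cmod (f x)) (norm x) \<le> real m"
      using real_arch_simple by blast
    then have "F k x = f x" if "k \<ge> m" for k
      using that by (simp add: F_def \<phi>_def Pid)
    then show "\<forall>\<^sub>F k in sequentially. F k x = f x"
      by (auto simp: eventually_sequentially)
  qed
  have "(\<lambda>k. \<integral>x. cmod (F k x - f x) \<partial>lborel) \<longlonglongrightarrow> (\<integral>x. 0 \<partial>(lborel :: 'a measure))"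
  proof (rule integral_dominated_convergence)
    show "integrable lborel (\<lambda>x. 2 * cmod (f x))" using f by simp
    show "AE x in lborel. (\<lambda>k. cmod (F k x - f x)) \<longlonglongrightarrow> 0"
      using Flim by (intro AE_I2 tendsto_norm_zero) (simp add: LIM_zero)
    show "AE x in lborel. norm (cmod (F k x - f x)) \<le> 2 * cmod (f x)" for k
      using Fle[of k] norm_triangle_ineq4[of "F k _" "f _"] by (auto intro!: AE_I2 order_trans[OF norm_triangle_ineq4])
  qed measurable
  then have "\<forall>\<^sub>F k in sequentially. (\<integral>x. cmod (F k x - f x) \<partial>lborel) < d / 2"
    using d by (intro order_tendstoD) auto
  moreover have "(\<lambda>k. L2_norm (\<lambda>x. F k x - f x)) \<longlonglongrightarrow> 0"
    using Flim Fle fL by (intro L2_dominated_convergence[where w=f]) auto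
  then have "\<forall>\<^sub>F k in sequentially. L2_norm (\<lambda>x. F k x - f x) < d / 2"
    using d by (intro order_tendstoD) auto
  ultimately have "\<forall>\<^sub>F k in sequentially. (\<integral>x. cmod (F k x - f x) \<partial>lborel) < d / 2 \<and>
      L2_norm (\<lambda>x. F k x - f x) < d / 2"
    by (rule eventually_conj)
  then obtain k where k: "(\<integral>x. cmod (F k x - f x) \<partial>lborel) < d / 2" "L2_norm (\<lambda>x. F k x - f x) < d / 2"
    by (metis (no_types, lifting) eventually_happens' sequentially_bot)
  \<comment> \<open>With k fixed, the same truncation applied to the continuous \<open>g n\<close>
    converges almost everywhere to \<open>F k\<close>. The bounded, compactly supported
    \<open>w\<close> dominates both, and each of the two stages costs d / 2.\<close>
  define h where "h n x = complex_of_real (\<phi> k x) * P k (g n x)" for n x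
  define w where "w x = complex_of_real (real k * indicator (cball (0::'a) (real k + 1)) x)" for x
  have bnd: "\<phi> k x * cmod (P k z) \<le> cmod (w x)" for x z
    using mult_mono[OF \<phi>0[of k x] Pk[of k z]] by (simp add: w_def norm_mult mult_ac)
  have hw: "cmod (h n x) \<le> cmod (w x)" for n x
    using bnd[of x "g n x"] \<phi>01[of k x] by (simp add: h_def norm_mult)
  have Fw: "cmod (F k x) \<le> cmod (w x)" for x
    using bnd[of x "f x"] \<phi>01[of k x] by (simp add: F_def norm_mult)
  have hc: "continuous_on UNIV (h n)" for n
    unfolding h_def by (intro continuous_intros \<phi>c continuous_on_compose2[OF Pc] g) auto
  have [measurable]: "h n \<in> borel_measurable borel" for n
    using hc by (rule borel_measurable_continuous_onI)
  have hlim: "AE x in lborel. (\<lambda>n. h n x) \<longlonglongrightarrow> F k x"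
    using AEN unfolding h_def F_def
  proof eventually_elim
    case (elim x)
    have "isCont (P k) (f x)"
      using Pc by (simp add: continuous_on_eq_continuous_at)
    then show ?case
      by (intro tendsto_intros isCont_tendsto_compose[of _ "P k"] elim)
  qed
  have ind: "integrable lborel (indicator (cball (0::'a) (real k + 1)) :: 'a \<Rightarrow> real)"
    using emeasure_lborel_cball_finite by (intro integrable_real_indicator) auto
  have wi: "integrable lborel w"
    unfolding w_def by (intro integrable_of_real integrable_mult_right ind)
  have "(\<lambda>x. (cmod (w x))\<^sup>2) = (\<lambda>x. (real k)\<^sup>2 * indicator (cball (0::'a) (real k + 1)) x)"
    by (auto simp: w_def norm_mult indicator_def)
  then have wL: "w \<in> L2_space"
    using ind borel_measurable_integrable[OF wi] by (simp add: L2_space_def)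
  note [measurable] = borel_measurable_integrable[OF wi]
  have hi: "integrable lborel (h n)" for n
    by (rule Bochner_Integration.integrable_bound[OF wi]) (use hw in auto)
  have hL: "h n \<in> L2_space" for n
  proof -
    have "integrable lborel (\<lambda>x. (cmod (h n x))\<^sup>2)"
      by (rule Bochner_Integration.integrable_bound[OF L2_spaceD(2)[OF wL]])
         (auto intro!: power_mono hw)
    then show ?thesis by (simp add: L2_space_def)
  qed
  have "(\<lambda>n. \<integral>x. cmod (h n x - F k x) \<partial>lborel) \<longlonglongrightarrow> (\<integral>x. 0 \<partial>(lborel :: 'a measure))"
  proof (rule integral_dominated_convergence)
    show "integrable lborel (\<lambda>x. 2 * cmod (w x))" using wi by simp
    show "AE x in lborel. (\<lambda>n. cmod (h n x - F k x)) \<longlonglongrightarrow> 0"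
      using hlim by eventually_elim (intro tendsto_norm_zero, simp add: LIM_zero)
    show "AE x in lborel. norm (cmod (h n x - F k x)) \<le> 2 * cmod (w x)" for n
    proof (rule AE_I2)
      fix x
      show "norm (cmod (h n x - F k x)) \<le> 2 * cmod (w x)"
        using hw[of n x] Fw[of x] norm_triangle_ineq4[of "h n x" "F k x"] by simp
    qed
  qed measurable
  then have "\<forall>\<^sub>F n in sequentially. (\<integral>x. cmod (h n x - F k x) \<partial>lborel) < d / 2"
    using d by (intro order_tendstoD) auto
  moreover have "(\<lambda>n. L2_norm (\<lambda>x. h n x - F k x)) \<longlonglongrightarrow> 0"
    using hlim hw wL by (intro L2_dominated_convergence[where w=w]) auto
  then have "\<forall>\<^sub>F n in sequentially. L2_norm (\<lambda>x. h n x - F k x) < d / 2"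
    using d by (intro order_tendstoD) auto
  ultimately have "\<forall>\<^sub>F n in sequentially. (\<integral>x. cmod (h n x - F k x) \<partial>lborel) < d / 2 \<and>
      L2_norm (\<lambda>x. h n x - F k x) < d / 2"
    by (rule eventually_conj)
  then obtain n where n: "(\<integral>x. cmod (h n x - F k x) \<partial>lborel) < d / 2" "L2_norm (\<lambda>x. h n x - F k x) < d / 2"
    by (metis (no_types, lifting) eventually_happens' sequentially_bot)
  have Fi: "integrable lborel (F k)"
    by (rule Bochner_Integration.integrable_bound[OF wi]) (use Fw in auto)
  have FL: "F k \<in> L2_space"
  proof -
    have "integrable lborel (\<lambda>x. (cmod (F k x))\<^sup>2)"
      by (rule Bochner_Integration.integrable_bound[OF L2_spaceD(2)[OF wL]])
         (auto intro!: power_mono Fw)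
    then show ?thesis by (simp add: L2_space_def)
  qed
  show ?thesis
  proof
    show "cmod (h n x) \<le> real k" for x
      using hw[of n x] by (auto simp: w_def norm_mult indicator_def split: split_of_bool_asm)
    have "(\<integral>x. cmod (h n x - f x) \<partial>lborel) \<le> (\<integral>x. cmod (h n x - F k x) + cmod (F k x - f x) \<partial>lborel)"
    proof (rule integral_mono)
      show "cmod (h n x - f x) \<le> cmod (h n x - F k x) + cmod (F k x - f x)" for x
        using norm_triangle_ineq[of "h n x - F k x" "F k x - f x"] by simp
    qed (use hi Fi f in auto)
    also have "\<dots> = (\<integral>x. cmod (h n x - F k x) \<partial>lborel) + (\<integral>x. cmod (F k x - f x) \<partial>lborel)"
      using hi Fi f by (intro Bochner_Integration.integral_add) auto
    finally show "(\<integral>x. cmod (h n x - f x) \<partial>lborel) < d" using n k by simp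
    show "L2_norm (\<lambda>x. h n x - f x) < d"
      using L2_norm_triangle_diff[OF hL FL fL, of n] n k by simp
  qed (use hc hi hL in auto)
qed

text \<open>Approximants converging in L1 have uniformly converging transforms; as they converge in
  L2 too, their transforms are Cauchy in L2. \<open>L2_Fatou\<close> shows that the two limits are
  the same function.\<close>

theorem fourier_integral_isometry:
  fixes f :: "'a::euclidean_space \<Rightarrow> complex"
  assumes f: "integrable lborel f" and fL: "f \<in> L2_space"
  shows "fourier_integral f \<in> L2_space"
    and "L2_norm (fourier_integral f) = sqrt (2 * pi) ^ DIM('a) * L2_norm f"
proof -
  define K where "K = sqrt (2 * pi) ^ DIM('a)"
  have K: "K > 0" by (simp add: K_def)
  \<comment> \<open>All requirements on the n-th approximant are bundled so that a single choice
    yields the sequence; \<open>Suc n\<close> keeps the tolerance positive at n = 0.\<close>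
  define Q where "Q n h \<longleftrightarrow> continuous_on UNIV h \<and> (\<exists>B. \<forall>x. cmod (h x) \<le> B) \<and> integrable lborel h \<and>
    h \<in> L2_space \<and> (\<integral>x. cmod (h x - f x) \<partial>lborel) < 1 / real (Suc n) \<and>
    L2_norm (\<lambda>x. h x - f x) < 1 / real (Suc n)" for n h
  have "\<exists>h. Q n h" for n
    by (rule continuous_approx[OF f fL, of "1 / real (Suc n)"]) (auto simp: Q_def)
  then obtain h where h: "\<And>n. Q n (h n)" by metis
  have "\<exists>B. \<forall>n x. cmod (h n x) \<le> B n"
    using h unfolding Q_def by (intro choice) blast
  then obtain B where hB: "\<And>n x. cmod (h n x) \<le> B n" by blast
  have hc: "continuous_on UNIV (h n)" and hi: "integrable lborel (h n)" and hL: "h n \<in> L2_space"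
    and h1: "(\<integral>x. cmod (h n x - f x) \<partial>lborel) < 1 / real (Suc n)"
    and h2: "L2_norm (\<lambda>x. h n x - f x) < 1 / real (Suc n)" for n
    using h[of n] unfolding Q_def by blast+
  note iso = fourier_integral_isometry_continuous[OF hc hB hi hL, folded K_def]
  have iso_diff: "L2_norm (\<lambda>x. fourier_integral (h m) x - fourier_integral (h n) x)
      = K * L2_norm (\<lambda>x. h m x - h n x)" for m n
  proof -
    have "cmod (h m x - h n x) \<le> B m + B n" for x
      using norm_triangle_ineq4[of "h m x" "h n x"] hB[of m x] hB[of n x] by linarith
    moreover have "continuous_on UNIV (\<lambda>x. h m x - h n x)"
      by (intro continuous_intros hc)
    ultimately have "L2_norm (fourier_integral (\<lambda>x. h m x - h n x)) = K * L2_norm (\<lambda>x. h m x - h n x)"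
      unfolding K_def using hi hL
      by (intro fourier_integral_isometry_continuous(2)[of _ "B m + B n"] L2_space_diff) auto
    then show ?thesis
      by (simp add: fourier_integral_diff[OF hi hi, abs_def])
  qed
  have inv0: "(\<lambda>n. 1 / real (Suc n)) \<longlonglongrightarrow> 0"
    by (rule LIMSEQ_Suc[OF lim_1_over_n])
  have h20: "(\<lambda>n. L2_norm (\<lambda>x. h n x - f x)) \<longlonglongrightarrow> 0"
    by (rule tendsto_sandwich[OF _ _ tendsto_const inv0]) (use h2[THEN less_imp_le] in \<open>simp_all add: always_eventually del: of_nat_Suc\<close>)
  have lim: "(\<lambda>n. fourier_integral (h n) \<xi>) \<longlonglongrightarrow> fourier_integral f \<xi>" for \<xi>
  proof (rule Lim_null_comparison[THEN LIM_zero_cancel, OF _ inv0])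
    have "cmod (fourier_integral (h n) \<xi> - fourier_integral f \<xi>) \<le> 1 / real (Suc n)" for n
      using cmod_fourier_integral_le[of "\<lambda>x. h n x - f x" \<xi>] h1[of n]
      by (simp add: fourier_integral_diff[OF hi f])
    then show "\<forall>\<^sub>F n in sequentially. norm (fourier_integral (h n) \<xi> - fourier_integral f \<xi>) \<le> 1 / real (Suc n)"
      by simp
  qed
  have Cauchy: "\<exists>N. \<forall>m\<ge>N. \<forall>n\<ge>N. L2_norm (\<lambda>x. fourier_integral (h m) x - fourier_integral (h n) x) \<le> e"
    if e: "e > 0" for e
  proof -
    have "\<forall>\<^sub>F n in sequentially. L2_norm (\<lambda>x. h n x - f x) < e / (2 * K)"
      using h20 e K by (intro order_tendstoD) auto
    then obtain N where N: "\<And>n. n \<ge> N \<Longrightarrow> L2_norm (\<lambda>x. h n x - f x) < e / (2 * K)"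
      by (auto simp: eventually_sequentially)
    have "K * L2_norm (\<lambda>x. h m x - h n x) \<le> e" if "m \<ge> N" "n \<ge> N" for m n
    proof -
      have "L2_norm (\<lambda>x. h m x - h n x) \<le> L2_norm (\<lambda>x. h m x - f x) + L2_norm (\<lambda>x. h n x - f x)"
        using L2_norm_triangle_diff[OF hL fL hL, of m n] L2_norm_minus[of f "h n"] by simp
      also have "\<dots> \<le> e / K" using N[OF that(1)] N[OF that(2)] by (simp add: field_simps)
      finally show ?thesis using K by (simp add: field_simps)
    qed
    then show ?thesis unfolding iso_diff by blast
  qed
  have "fourier_integral f \<in> borel_measurable borel"
    using borel_measurable_integrable[OF f] by (intro fourier_integral_measurable) simp
  note F = L2_Fatou[of "\<lambda>n. fourier_integral (h n)", OF iso(1) this _ Cauchy]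
  have F1: "fourier_integral f \<in> L2_space"
    and F2: "(\<lambda>n. L2_norm (\<lambda>x. fourier_integral (h n) x - fourier_integral f x)) \<longlonglongrightarrow> 0"
    using F lim by simp_all
  show "fourier_integral f \<in> L2_space" by (fact F1)
  have "(\<lambda>n. L2_norm (fourier_integral (h n))) \<longlonglongrightarrow> L2_norm (fourier_integral f)"
    by (rule L2_tendsto_norm[OF iso(1) F1 F2])
  moreover have "(\<lambda>n. L2_norm (fourier_integral (h n))) \<longlonglongrightarrow> K * L2_norm f"
    unfolding iso(2) by (intro tendsto_intros L2_tendsto_norm hL fL h20)
  ultimately show "L2_norm (fourier_integral f) = sqrt (2 * pi) ^ DIM('a) * L2_norm f"
    unfolding K_def by (rule LIMSEQ_unique)
qed

section \<open>Extension of the transform to L2\<close>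

lemma
  fixes u :: "'a::euclidean_space \<Rightarrow> complex"
  assumes u: "u \<in> L2_space"
  shows L2_truncate: "(\<lambda>x. indicator (cball 0 (real n)) x * u x) \<in> L2_space"
    and integrable_truncate: "integrable lborel (\<lambda>x. indicator (cball 0 (real n)) x * u x)"
    and tendsto_truncate: "(\<lambda>n. L2_norm (\<lambda>x. indicator (cball 0 (real n)) x * u x - u x)) \<longlonglongrightarrow> 0"
proof -
  note [measurable] = L2_spaceD(1)[OF u]
  show T: "(\<lambda>x. indicator (cball 0 (real n)) x * u x) \<in> L2_space" for n
    using u by (rule L2_space_indicator) simp
  have "integrable lborel (\<lambda>x. (cmod (indicator (cball (0::'a) (real n)) x))\<^sup>2)"
  proof -
    have "integrable lborel (indicator (cball (0::'a) (real n)) :: 'a \<Rightarrow> real)"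
      using emeasure_lborel_cball_finite by (intro integrable_real_indicator) auto
    moreover have "(\<lambda>x. (cmod (indicator (cball (0::'a) (real n)) x))\<^sup>2) = indicator (cball 0 (real n))"
      by (auto simp: indicator_def)
    ultimately show ?thesis by simp
  qed
  then have "(\<lambda>x. indicator (cball 0 (real n)) x :: complex) \<in> (L2_space :: ('a \<Rightarrow> complex) set)"
    by (auto simp: L2_space_def intro!: borel_measurable_indicator)
  then show "integrable lborel (\<lambda>x. indicator (cball 0 (real n)) x * u x)"
    using u by (rule L2_pair_integrable)
  show "(\<lambda>n. L2_norm (\<lambda>x. indicator (cball 0 (real n)) x * u x - u x)) \<longlonglongrightarrow> 0"
  proof (rule L2_dominated_convergence[OF L2_spaceD(1)[OF T] L2_spaceD(1)[OF u] _ u])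
    show "AE x in lborel. (\<lambda>n. indicator (cball 0 (real n)) x * u x) \<longlonglongrightarrow> u x"
    proof (intro AE_I2 tendsto_eventually)
      fix x :: 'a
      obtain m :: nat where "norm x \<le> real m" using real_arch_simple by blast
      then show "\<forall>\<^sub>F n in sequentially. indicator (cball 0 (real n)) x * u x = u x"
        by (intro eventually_sequentiallyI[of m]) auto
    qed
    show "cmod (indicator (cball 0 (real n)) x * u x) \<le> cmod (u x)" for n x
      by (auto simp: indicator_def)
  qed
qed

text \<open>Truncations to balls are integrable, so the isometry applies to them and to their
  differences; the transforms are Cauchy, and \<open>L2_complete\<close> exhibits a function fitting
  the description under \<open>SOME\<close>. Only with this witness do the defining properties pass
  to \<open>fourier u\<close>.\<close>

lemma
  fixes u :: "'a::euclidean_space \<Rightarrow> complex"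
  assumes u: "u \<in> L2_space"
  shows fourier_L2: "fourier u \<in> L2_space"
    and fourier_tendsto: "(\<lambda>n. L2_norm (\<lambda>\<xi>. fourier_integral (\<lambda>x. indicator (cball 0 (real n)) x * u x) \<xi>
        - fourier u \<xi>)) \<longlonglongrightarrow> 0"
    and L2_norm_fourier: "L2_norm (fourier u) = sqrt (2 * pi) ^ DIM('a) * L2_norm u"
proof -
  define K where "K = sqrt (2 * pi) ^ DIM('a)"
  have K: "K > 0" by (simp add: K_def)
  define T where "T = (\<lambda>n x. indicator (cball 0 (real n)) x * u x)"
  have TL: "T n \<in> L2_space" and Ti: "integrable lborel (T n)" for n
    unfolding T_def by (rule L2_truncate[OF u], rule integrable_truncate[OF u])
  have T0: "(\<lambda>n. L2_norm (\<lambda>x. T n x - u x)) \<longlonglongrightarrow> 0"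
    unfolding T_def by (rule tendsto_truncate[OF u])
  note iso = fourier_integral_isometry[OF Ti TL, folded K_def]
  have iso_diff: "L2_norm (\<lambda>x. fourier_integral (T m) x - fourier_integral (T n) x)
      = K * L2_norm (\<lambda>x. T m x - T n x)" for m n
    using fourier_integral_isometry(2)[of "\<lambda>x. T m x - T n x"] Ti TL
    by (simp add: K_def fourier_integral_diff[OF Ti Ti, abs_def] L2_space_diff)
  have Cauchy: "\<exists>N. \<forall>m\<ge>N. \<forall>n\<ge>N. L2_norm (\<lambda>x. fourier_integral (T m) x - fourier_integral (T n) x) \<le> e"
    if e: "e > 0" for e
  proof -
    have "\<forall>\<^sub>F n in sequentially. L2_norm (\<lambda>x. T n x - u x) < e / (2 * K)"
      using T0 e K by (intro order_tendstoD) auto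
    then obtain N where N: "\<And>n. n \<ge> N \<Longrightarrow> L2_norm (\<lambda>x. T n x - u x) < e / (2 * K)"
      by (auto simp: eventually_sequentially)
    have "K * L2_norm (\<lambda>x. T m x - T n x) \<le> e" if "m \<ge> N" "n \<ge> N" for m n
    proof -
      have "L2_norm (\<lambda>x. T m x - T n x) \<le> L2_norm (\<lambda>x. T m x - u x) + L2_norm (\<lambda>x. T n x - u x)"
        using L2_norm_triangle_diff[OF TL u TL, of m n] L2_norm_minus[of u "T n"] by simp
      also have "\<dots> \<le> e / K" using N[OF that(1)] N[OF that(2)] by (simp add: field_simps)
      finally show ?thesis using K by (simp add: field_simps)
    qed
    then show ?thesis unfolding iso_diff by blast
  qed
  \<comment> \<open>The extended distance in the definition of \<open>fourier\<close> is the square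
    of \<open>L2_norm\<close> here, so the two notions of convergence can be exchanged.\<close>
  have nn: "(\<integral>\<^sup>+ \<Xi>. ennreal ((cmod (fourier_integral (T n) \<Xi> - v \<Xi>))\<^sup>2) \<partial>lborel)
      = ennreal ((L2_norm (\<lambda>\<xi>. fourier_integral (T n) \<xi> - v \<xi>))\<^sup>2)" if "v \<in> L2_space" for v n
    by (rule nn_integral_L2[OF L2_space_diff[OF iso(1) that]])
  obtain v where v: "v \<in> L2_space" "(\<lambda>n. L2_norm (\<lambda>\<xi>. fourier_integral (T n) \<xi> - v \<xi>)) \<longlonglongrightarrow> 0"
    using L2_complete[OF iso(1) Cauchy] by blast
  have "(\<lambda>n. \<integral>\<^sup>+ \<Xi>. ennreal ((cmod (fourier_integral (T n) \<Xi> - v \<Xi>))\<^sup>2) \<partial>lborel) \<longlonglongrightarrow> ennreal (0\<^sup>2)"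
    unfolding nn[OF v(1)] by (intro tendsto_intros v(2))
  with v(1) have "\<exists>v. v \<in> L2_space \<and>
     (\<lambda>n. \<integral>\<^sup>+ \<Xi>. ennreal ((cmod (fourier_integral (T n) \<Xi> - v \<Xi>))\<^sup>2) \<partial>lborel) \<longlonglongrightarrow> 0" by auto
  from someI_ex[OF this] have F1: "fourier u \<in> L2_space" and
    F2: "(\<lambda>n. \<integral>\<^sup>+ \<Xi>. ennreal ((cmod (fourier_integral (T n) \<Xi> - fourier u \<Xi>))\<^sup>2) \<partial>lborel) \<longlonglongrightarrow> 0"
    unfolding fourier_def T_def by auto
  have "(\<lambda>n. (L2_norm (\<lambda>\<xi>. fourier_integral (T n) \<xi> - fourier u \<xi>))\<^sup>2) \<longlonglongrightarrow> 0"
    using F2 unfolding nn[OF F1] ennreal_0[symmetric] by (subst (asm) tendsto_ennreal_iff) auto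
  then have "(\<lambda>n. sqrt ((L2_norm (\<lambda>\<xi>. fourier_integral (T n) \<xi> - fourier u \<xi>))\<^sup>2)) \<longlonglongrightarrow> sqrt 0"
    by (rule tendsto_real_sqrt)
  then have F3: "(\<lambda>n. L2_norm (\<lambda>\<xi>. fourier_integral (T n) \<xi> - fourier u \<xi>)) \<longlonglongrightarrow> 0"
    by simp
  show "fourier u \<in> L2_space" by (fact F1)
  show "(\<lambda>n. L2_norm (\<lambda>\<xi>. fourier_integral (\<lambda>x. indicator (cball 0 (real n)) x * u x) \<xi>
        - fourier u \<xi>)) \<longlonglongrightarrow> 0"
    using F3 unfolding T_def .
  have "(\<lambda>n. L2_norm (fourier_integral (T n))) \<longlonglongrightarrow> L2_norm (fourier u)"
    by (rule L2_tendsto_norm[OF iso(1) F1 F3])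
  moreover have "(\<lambda>n. L2_norm (fourier_integral (T n))) \<longlonglongrightarrow> K * L2_norm u"
    unfolding iso(2) by (intro tendsto_intros L2_tendsto_norm TL u T0)
  ultimately show "L2_norm (fourier u) = sqrt (2 * pi) ^ DIM('a) * L2_norm u"
    unfolding K_def by (rule LIMSEQ_unique)
qed

text \<open>On truncations this is the Fubini identity for integrable functions; both sides pass to
  the limit by \<open>L2_pair_tendsto\<close>.\<close>

lemma fourier_mult_formula:
  fixes u v :: "'a::euclidean_space \<Rightarrow> complex"
  assumes u: "u \<in> L2_space" and v: "v \<in> L2_space"
  shows "(\<integral>\<xi>. fourier u \<xi> * v \<xi> \<partial>lborel) = (\<integral>x. u x * fourier v x \<partial>lborel)"
proof (rule LIMSEQ_unique)
  let ?T = "\<lambda>w n x. indicator (cball 0 (real n)) x * w x"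
  note iso = fourier_integral_isometry(1)[OF integrable_truncate L2_truncate]
  show "(\<lambda>n. \<integral>\<xi>. fourier_integral (?T u n) \<xi> * ?T v n \<xi> \<partial>lborel) \<longlonglongrightarrow> (\<integral>\<xi>. fourier u \<xi> * v \<xi> \<partial>lborel)"
    using u v by (intro L2_pair_tendsto iso fourier_L2 fourier_tendsto L2_truncate tendsto_truncate)
  have "(\<integral>\<xi>. fourier_integral (?T u n) \<xi> * ?T v n \<xi> \<partial>lborel)
      = (\<integral>\<xi>. ?T u n \<xi> * fourier_integral (?T v n) \<xi> \<partial>lborel)" for n
    by (rule fourier_integral_mult_formula[OF integrable_truncate[OF u] integrable_truncate[OF v]])
  moreover have "(\<lambda>n. \<integral>\<xi>. ?T u n \<xi> * fourier_integral (?T v n) \<xi> \<partial>lborel) \<longlonglongrightarrow> (\<integral>\<xi>. u \<xi> * fourier v \<xi> \<partial>lborel)"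
    using u v by (intro L2_pair_tendsto iso fourier_L2 fourier_tendsto L2_truncate tendsto_truncate)
  ultimately show "(\<lambda>n. \<integral>\<xi>. fourier_integral (?T u n) \<xi> * ?T v n \<xi> \<partial>lborel) \<longlonglongrightarrow> (\<integral>\<xi>. u \<xi> * fourier v \<xi> \<partial>lborel)"
    by simp
qed

text \<open>By the multiplication formula \<open>J v = cnj (\<F> (cnj v))\<close> is the adjoint of \<open>\<F>\<close>. Both are
  isometries up to the factor \<open>sqrt c\<close>, so expanding the square gives
  \<open>\<parallel>\<F> (J v) - c v\<parallel>\<^sup>2 = c\<^sup>2 \<parallel>v\<parallel>\<^sup>2 - 2 c\<^sup>2 \<parallel>v\<parallel>\<^sup>2 + c\<^sup>2 \<parallel>v\<parallel>\<^sup>2 = 0\<close>.\<close>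

theorem fourier_surj:
  fixes v :: "'a::euclidean_space \<Rightarrow> complex"
  assumes v: "v \<in> L2_space"
  obtains u where "u \<in> L2_space" "AE \<xi> in lborel. fourier u \<xi> = v \<xi>"
proof -
  define K where "K = sqrt (2 * pi) ^ DIM('a)"
  have K: "K > 0" by (simp add: K_def)
  \<comment> \<open>Dividing by \<open>K\<^sup>2\<close>, the constant c of the identity above,
    makes \<open>u\<close> itself the preimage rather than a multiple of it.\<close>
  define w where "w = (\<lambda>x. complex_of_real (1 / K\<^sup>2) * v x)"
  have w: "w \<in> L2_space" unfolding w_def by (rule L2_space_scale[OF v])
  note cw = L2_space_cnj[OF w]
  define G where "G = fourier (\<lambda>x. cnj (w x))"
  have G: "G \<in> L2_space" unfolding G_def by (rule fourier_L2[OF cw])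
  define u where "u = (\<lambda>x. cnj (G x))"
  have u: "u \<in> L2_space" unfolding u_def by (rule L2_space_cnj[OF G])
  have nG: "(L2_norm G)\<^sup>2 = K\<^sup>2 * (L2_norm w)\<^sup>2"
    by (simp add: G_def L2_norm_fourier[OF cw] K_def L2_norm_cnj power_mult_distrib)
  have nFu: "(L2_norm (fourier u))\<^sup>2 = K\<^sup>2 * (L2_norm G)\<^sup>2"
    by (simp add: L2_norm_fourier[OF u] K_def power_mult_distrib) (simp add: u_def L2_norm_cnj)
  have vw: "v x = complex_of_real (K\<^sup>2) * w x" for x
    using K by (simp add: w_def)
  have nv: "(L2_norm v)\<^sup>2 = K\<^sup>2 * K\<^sup>2 * (L2_norm w)\<^sup>2"
  proof -
    have "(cmod (v x))\<^sup>2 = K\<^sup>2 * K\<^sup>2 * (cmod (w x))\<^sup>2" for x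
      by (simp add: vw norm_mult norm_power power_mult_distrib power2_eq_square)
    then show ?thesis by (simp only: L2_norm_sq integral_mult_right_zero)
  qed
  have "(\<integral>x. fourier u x * cnj (w x) \<partial>lborel) = (\<integral>x. cnj (G x) * G x \<partial>lborel)"
    using fourier_mult_formula[OF u cw] by (simp add: u_def G_def)
  also have "\<dots> = (\<integral>x. complex_of_real ((cmod (G x))\<^sup>2) \<partial>lborel)"
    by (intro Bochner_Integration.integral_cong refl) (simp only: complex_norm_square mult.commute)
  also have "\<dots> = complex_of_real ((L2_norm G)\<^sup>2)"
    by (simp add: L2_norm_sq del: of_real_power)
  finally have pair: "(\<integral>x. fourier u x * cnj (v x) \<partial>lborel) = complex_of_real (K\<^sup>2 * (L2_norm G)\<^sup>2)"
    by (simp add: vw mult.left_commute[of "fourier u _"])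
  define p where "p = (\<lambda>x. fourier u x * cnj (v x))"
  have i: "integrable lborel p"
    unfolding p_def by (rule L2_pair_integrable[OF fourier_L2[OF u] L2_space_cnj[OF v]])
  have "cmod (a - b)^2 = (cmod a)\<^sup>2 - 2 * Re (a * cnj b) + (cmod b)\<^sup>2" for a b
    unfolding cmod_power2 by (simp add: power2_eq_square algebra_simps)
  then have "(L2_norm (\<lambda>x. fourier u x - v x))\<^sup>2
      = (\<integral>x. (cmod (fourier u x))\<^sup>2 - 2 * Re (p x) + (cmod (v x))\<^sup>2 \<partial>lborel)"
    by (simp add: L2_norm_sq p_def)
  also have "\<dots> = (L2_norm (fourier u))\<^sup>2 - 2 * Re (\<integral>x. p x \<partial>lborel) + (L2_norm v)\<^sup>2"
    unfolding L2_norm_sq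
    using L2_spaceD(2)[OF fourier_L2[OF u]] L2_spaceD(2)[OF v] i by simp
  also have "\<dots> = 0"
    unfolding p_def pair nFu nv nG by simp
  finally have "L2_norm (\<lambda>x. fourier u x - v x) = 0" by simp
  then have "AE x in lborel. fourier u x - v x = 0"
    by (rule L2_norm_zero_AE[OF L2_space_diff[OF fourier_L2[OF u] v]])
  then show ?thesis by (intro that[OF u]) auto
qed

section \<open>The angular weight along rays\<close>

text \<open>Put c = cos x. Up to x = 2 the Taylor formula of order 4 gives 1 - cos x >= x^2 / 3;
  beyond 2 the cosine is nonpositive while x <= pi < 4, whence the 16.\<close>

lemma arccos_sq_le:
  assumes "-1 \<le> c" "c \<le> 1"
  shows "(arccos c)\<^sup>2 \<le> 16 * (1 - c)"
proof -
  define x where "x = arccos c"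
  have x: "0 \<le> x" "x \<le> pi" "cos x = c"
    using arccos[OF assms] by (auto simp: x_def)
  have "x\<^sup>2 \<le> 16 * (1 - cos x)"
  proof (cases "x \<le> 2")
    case True
    show ?thesis
    proof (cases "x = 0")
      case False
      then have "x > 0" using x by simp
      then obtain t where t: "cos x = (\<Sum>m<4. cos_coeff m * x ^ m) + (cos (t + 1/2 * real 4 * pi) / fact 4) * x ^ 4"
        using Maclaurin_cos_expansion2[of x 4] by auto
      have sum: "(\<Sum>m<4. cos_coeff m * x ^ m) = 1 - x\<^sup>2 / 2"
      proof -
        have "{..<4::nat} = {0, 1, 2, 3}" by auto
        then show ?thesis by (simp add: cos_coeff_def)
      qed
      have "(cos (t + 1/2 * real 4 * pi) / fact 4) * x ^ 4 \<le> (1 / fact 4) * x ^ 4"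
        by (intro mult_right_mono divide_right_mono cos_le_one) auto
      also have "\<dots> = x\<^sup>2 * x\<^sup>2 / 24"
        by (simp add: fact_numeral power2_eq_square power4_eq_xxxx)
      also have "\<dots> \<le> x\<^sup>2 * 4 / 24"
        using power_mono[of x 2 2] True x by (intro divide_right_mono mult_left_mono) auto
      finally have "cos x \<le> 1 - x\<^sup>2 / 2 + x\<^sup>2 * 4 / 24"
        using t sum by linarith
      moreover obtain y where "x\<^sup>2 = y" "0 \<le> y" by simp
      ultimately show ?thesis by simp
    qed simp
  next
    case False
    then have "x \<ge> pi / 2" using pi_less_4 by linarith
    then have "cos x \<le> 0"
      using x cos_monotone_0_pi_le[of "pi/2" x] by simp
    moreover have "x\<^sup>2 \<le> 4\<^sup>2"
      using x pi_less_4 by (intro power_mono) auto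
    ultimately show ?thesis by simp
  qed
  then show ?thesis using x by (simp add: x_def)
qed

text \<open>Cauchy-Schwarz; if a vector vanishes, the quotient is 0 by the convention for
  division.\<close>

lemma inner_div_norms_bounds: "-1 \<le> (a \<bullet> b) / (norm a * norm b)" "(a \<bullet> b) / (norm a * norm b) \<le> 1"
proof -
  have "\<bar>(a \<bullet> b) / (norm a * norm b)\<bar> \<le> 1"
    using Cauchy_Schwarz_ineq2[of a b] by (auto simp: abs_mult divide_le_eq_1)
  then show "-1 \<le> (a \<bullet> b) / (norm a * norm b)" "(a \<bullet> b) / (norm a * norm b) \<le> 1" by linarith+
qed

text \<open>\<open>arccos\<close> is continuous only on [-1, 1]. Clamping its argument gives a
  continuous function on the whole line and changes no value, as the quotient already lies in that
  interval.\<close>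

lemma vec_angle_measurable [measurable]:
  fixes f g :: "'b \<Rightarrow> 'a::euclidean_space"
  assumes [measurable]: "f \<in> borel_measurable N" "g \<in> borel_measurable N"
  shows "(\<lambda>x. vec_angle (f x) (g x)) \<in> borel_measurable N"
proof -
  have "continuous_on UNIV (\<lambda>c::real. arccos (max (-1) (min 1 c)))"
    by (intro continuous_on_compose2[OF continuous_on_arccos'] continuous_intros) auto
  then have [measurable]: "(\<lambda>c::real. arccos (max (-1) (min 1 c))) \<in> borel_measurable borel"
    by (rule borel_measurable_continuous_onI)
  have "vec_angle a b = arccos (max (-1) (min 1 ((a \<bullet> b) / (norm a * norm b))))" for a b :: 'a
    using inner_div_norms_bounds[of a b] by (simp add: vec_angle_def)
  then show ?thesis by simp
qed

text \<open>With the phase \<phi> and its derivative D >= 0 one has \<theta>^2 <= 16 D. The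
  parameters for which \<phi> stays in a window of length 2 \<delta> form an interval, over which D
  integrates to an increment of \<phi>, at most 2 \<delta>; hence 32 \<delta>. The cap
  \<open>R\<close> makes that interval compact, and the bound is uniform in it.\<close>

lemma nn_integral_angle_ray:
  fixes p q :: "'a::euclidean_space"
  assumes p: "norm p \<ge> 1" and s: "s1 \<in> {-1, 1::real}" "s2 \<in> {-1, 1}" and l: "\<delta> \<ge> 0"
  shows "(\<integral>\<^sup>+t. ennreal ((vec_angle (s1 *\<^sub>R (t *\<^sub>R p)) (s2 *\<^sub>R (q - t *\<^sub>R p)))\<^sup>2)
      * indicator {t. 0 < t \<and> t \<le> R \<and> \<bar>\<tau> - s1 * norm (t *\<^sub>R p) - s2 * norm (q - t *\<^sub>R p)\<bar> \<le> \<delta>} t \<partial>lborel)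
    \<le> ennreal (32 * \<delta>)"
proof -
  \<comment> \<open>The phase is multiplied by \<open>s1\<close>: this preserves the modulus of its
    deviation from \<tau> and gives the term \<open>t * norm p\<close> the coefficient +1, so \<phi>
    is nondecreasing for every choice of signs.\<close>
  define \<phi> where "\<phi> t = t * norm p + s1 * s2 * norm (q - t *\<^sub>R p)" for t
  \<comment> \<open>The derivative of \<phi> away from q = t p; at such a point the quotient is 0 by
    convention and D t = norm p, so D is nonnegative at every t.\<close>
  define D where "D t = norm p - s1 * s2 * ((p \<bullet> (q - t *\<^sub>R p)) / norm (q - t *\<^sub>R p))" for t
  define S where "S = {t. 0 \<le> t \<and> t \<le> R \<and> \<bar>s1 * \<tau> - \<phi> t\<bar> \<le> \<delta>}"
  have ss: "s1 * s1 = 1" "\<bar>s1\<bar> = 1" "\<bar>s1 * s2\<bar> = 1" "(s1 * s2) \<in> {-1, 1}" using s by auto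
  have p0: "norm p \<noteq> 0" using p by auto
  have D0: "0 \<le> D t" for t
  proof -
    have "\<bar>(p \<bullet> (q - t *\<^sub>R p)) / norm (q - t *\<^sub>R p)\<bar> \<le> norm p"
      using Cauchy_Schwarz_ineq2[of p "q - t *\<^sub>R p"] by (auto simp: abs_mult divide_le_eq)
    then have "\<bar>s1 * s2 * ((p \<bullet> (q - t *\<^sub>R p)) / norm (q - t *\<^sub>R p))\<bar> \<le> norm p"
      by (simp only: abs_mult[of "s1 * s2"] ss mult_1)
    then show ?thesis unfolding D_def by linarith
  qed
  have angle: "(vec_angle (s1 *\<^sub>R (t *\<^sub>R p)) (s2 *\<^sub>R (q - t *\<^sub>R p)))\<^sup>2 \<le> 16 * D t" if t: "t > 0" for t
  proof -
    let ?a = "s1 *\<^sub>R (t *\<^sub>R p)" and ?b = "s2 *\<^sub>R (q - t *\<^sub>R p)"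
    have eq: "(?a \<bullet> ?b) / (norm ?a * norm ?b) = s1 * s2 * ((p \<bullet> (q - t *\<^sub>R p)) / norm (q - t *\<^sub>R p)) / norm p"
    proof -
      have ab: "?a \<bullet> ?b = t * (s1 * s2 * (p \<bullet> (q - t *\<^sub>R p)))" by simp
      have na: "norm ?a = t * norm p" using t ss by (simp add: abs_mult)
      have nb: "norm ?b = norm (q - t *\<^sub>R p)" using s by auto
      show ?thesis unfolding ab na nb using t by (simp add: mult_ac)
    qed
    have "(vec_angle ?a ?b)\<^sup>2 \<le> 16 * (1 - (?a \<bullet> ?b) / (norm ?a * norm ?b))"
      unfolding vec_angle_def by (intro arccos_sq_le inner_div_norms_bounds)
    also have "\<dots> = 16 * (D t / norm p)"
      unfolding eq D_def using p0 by (simp add: diff_divide_distrib)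
    \<comment> \<open>The normalisation \<open>1 \<le> norm p\<close> removes the denominator; the
      slope directions used below satisfy it.\<close>
    also have "\<dots> \<le> 16 * D t"
      using D0[of t] p p0 mult_left_mono[of 1 "norm p" "D t"] by (simp add: divide_le_eq)
    finally show ?thesis .
  qed
  have mono: "\<phi> t \<le> \<phi> t'" if "t \<le> t'" for t t'
  proof -
    have "\<bar>norm (q - t *\<^sub>R p) - norm (q - t' *\<^sub>R p)\<bar> \<le> norm ((q - t *\<^sub>R p) - (q - t' *\<^sub>R p))"
      by (rule norm_triangle_ineq3)
    also have "(q - t *\<^sub>R p) - (q - t' *\<^sub>R p) = (t' - t) *\<^sub>R p" by (simp add: algebra_simps)
    also have "norm \<dots> = (t' - t) * norm p" using that by simp
    finally show ?thesis
      using ss(4) unfolding \<phi>_def left_diff_distrib by (elim insertE emptyE) simp_all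
  qed
  have cont: "continuous_on A \<phi>" for A
    unfolding \<phi>_def by (intro continuous_intros)
  have "S = {0..R} \<inter> \<phi> -` {s1 * \<tau> - \<delta> .. s1 * \<tau> + \<delta>}"
    by (auto simp: S_def abs_le_iff)
  then have "closed S"
    using cont by (auto intro!: continuous_closed_preimage)
  moreover have "S \<subseteq> {0..R}" by (auto simp: S_def)
  ultimately have "compact S"
    using bounded_closed_interval bounded_subset compact_eq_bounded_closed by blast
  \<comment> \<open>Monotonicity of \<phi> makes S an interval. Together with compactness this gives
    S = {a..b}, where a > b encodes the empty set.\<close>
  moreover have "connected S"
  proof -
    have "t \<in> S" if "a \<in> S" "b \<in> S" "a \<le> t" "t \<le> b" for a b t
    proof -
      have "\<phi> a \<le> \<phi> t" "\<phi> t \<le> \<phi> b" using that by (auto intro: mono)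
      then show ?thesis using that unfolding S_def mem_Collect_eq by linarith
    qed
    then have "is_interval S" unfolding is_interval_1 by blast
    then show ?thesis by (simp only: is_interval_connected_1)
  qed
  ultimately obtain a b where ab: "S = {a..b}"
    using connected_compact_interval_1[of S] by (auto simp: cbox_interval)
  have Dm[measurable]: "D \<in> borel_measurable borel" unfolding D_def by measurable
  have variation: "(\<integral>\<^sup>+t. ennreal (indicator {a..b} t * D t) \<partial>lborel) \<le> ennreal (2 * \<delta>)"
  proof (cases "a \<le> b")
    case True
    have aS: "a \<in> S" "b \<in> S" using True by (auto simp: ab)
    \<comment> \<open>The norm is not differentiable where q - t p vanishes. This happens for at
      most one t, and since \<phi> is continuous the fundamental theorem tolerates a finite
      exceptional set.\<close>
    define Z where "Z = {t. q = t *\<^sub>R p}"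
    have "finite Z"
    proof (cases "Z = {}")
      case False
      then obtain t0 where "q = t0 *\<^sub>R p" by (auto simp: Z_def)
      then have "Z \<subseteq> {t0}" using p by (auto simp: Z_def)
      then show ?thesis by (rule finite_subset) simp
    qed simp
    then have "(D has_integral (\<phi> b - \<phi> a)) {a..b}"
    proof (rule fundamental_theorem_of_calculus_interior_strong[OF _ True])
      fix t assume "t \<in> {a<..<b} - Z"
      then have nz: "q - t *\<^sub>R p \<noteq> 0" by (auto simp: Z_def)
      have "((\<lambda>t. norm (q - t *\<^sub>R p)) has_derivative
          (\<lambda>h. (0 - h *\<^sub>R p) \<bullet> sgn (q - t *\<^sub>R p))) (at t)"
      proof (rule has_derivative_compose[of "\<lambda>t. q - t *\<^sub>R p" "\<lambda>h. 0 - h *\<^sub>R p" t UNIV norm])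
        show "((\<lambda>t. q - t *\<^sub>R p) has_derivative (\<lambda>h. 0 - h *\<^sub>R p)) (at t)"
          by (intro derivative_intros)
      qed (rule has_derivative_norm[OF nz])
      then have "(\<phi> has_derivative (\<lambda>h. h * norm p + s1 * s2 * ((0 - h *\<^sub>R p) \<bullet> sgn (q - t *\<^sub>R p)))) (at t)"
        unfolding \<phi>_def by (auto intro!: derivative_eq_intros)
      moreover have "(\<lambda>h. h * norm p + s1 * s2 * ((0 - h *\<^sub>R p) \<bullet> sgn (q - t *\<^sub>R p))) = (\<lambda>h. h *\<^sub>R D t)"
        by (auto simp: D_def sgn_div_norm divide_inverse algebra_simps)
      ultimately show "(\<phi> has_vector_derivative D t) (at t)"
        by (simp add: has_vector_derivative_def)
    qed (rule cont)
    then have "((\<lambda>t. indicator {a..b} t * D t) has_integral (\<phi> b - \<phi> a)) UNIV"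
      by (subst (asm) has_integral_restrict_UNIV[symmetric])
         (auto elim!: has_integral_eq[rotated] simp: indicator_def)
    then have "(\<integral>\<^sup>+t. ennreal (indicator {a..b} t * D t) \<partial>lborel) = ennreal (\<phi> b - \<phi> a)"
      by (intro nn_integral_has_integral_lborel) (use D0 in auto)
    also have "\<phi> b - \<phi> a \<le> 2 * \<delta>"
      using aS by (auto simp: S_def)
    finally show ?thesis by (simp add: ennreal_leI)
  qed simp
  have "(\<integral>\<^sup>+t. ennreal ((vec_angle (s1 *\<^sub>R (t *\<^sub>R p)) (s2 *\<^sub>R (q - t *\<^sub>R p)))\<^sup>2)
      * indicator {t. 0 < t \<and> t \<le> R \<and> \<bar>\<tau> - s1 * norm (t *\<^sub>R p) - s2 * norm (q - t *\<^sub>R p)\<bar> \<le> \<delta>} t \<partial>lborel)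
    \<le> (\<integral>\<^sup>+t. 16 * ennreal (indicator {a..b} t * D t) \<partial>lborel)"
  proof (rule nn_integral_mono)
    fix t
    show "ennreal ((vec_angle (s1 *\<^sub>R (t *\<^sub>R p)) (s2 *\<^sub>R (q - t *\<^sub>R p)))\<^sup>2)
      * indicator {t. 0 < t \<and> t \<le> R \<and> \<bar>\<tau> - s1 * norm (t *\<^sub>R p) - s2 * norm (q - t *\<^sub>R p)\<bar> \<le> \<delta>} t
      \<le> 16 * ennreal (indicator {a..b} t * D t)"
    proof (cases "0 < t \<and> t \<le> R \<and> \<bar>\<tau> - s1 * norm (t *\<^sub>R p) - s2 * norm (q - t *\<^sub>R p)\<bar> \<le> \<delta>")
      case True
      have "s1 * \<tau> - \<phi> t = s1 * (\<tau> - s1 * norm (t *\<^sub>R p) - s2 * norm (q - t *\<^sub>R p))"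
      proof -
        have "s1 * (\<tau> - s1 * norm (t *\<^sub>R p) - s2 * norm (q - t *\<^sub>R p))
            = s1 * \<tau> - ((s1 * s1) * norm (t *\<^sub>R p) + s1 * s2 * norm (q - t *\<^sub>R p))"
          by (simp only: right_diff_distrib distrib_left mult.assoc diff_diff_eq)
        then show ?thesis using True by (simp add: \<phi>_def ss(1))
      qed
      then have "\<bar>s1 * \<tau> - \<phi> t\<bar> \<le> \<delta>"
        using True by (simp only: abs_mult ss mult_1)
      then have "t \<in> {a..b}" unfolding ab[symmetric] using True by (simp add: S_def)
      moreover have "ennreal ((vec_angle (s1 *\<^sub>R (t *\<^sub>R p)) (s2 *\<^sub>R (q - t *\<^sub>R p)))\<^sup>2) \<le> ennreal (16 * D t)"
        using True by (intro ennreal_leI angle) auto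
      moreover have "indicator {t. 0 < t \<and> t \<le> R \<and> \<bar>\<tau> - s1 * norm (t *\<^sub>R p) - s2 * norm (q - t *\<^sub>R p)\<bar> \<le> \<delta>} t
          = (1 :: ennreal)"
        by (rule indicator_simps(1)) (rule CollectI, fact True)
      ultimately show ?thesis using D0[of t] by (simp only: mult_1_right) (simp add: ennreal_mult)
    qed simp
  qed
  also have "\<dots> = 16 * (\<integral>\<^sup>+t. ennreal (indicator {a..b} t * D t) \<partial>lborel)"
    by (rule nn_integral_cmult) measurable
  also have "\<dots> \<le> 16 * ennreal (2 * \<delta>)"
    by (rule mult_left_mono[OF variation]) simp
  also have "\<dots> = ennreal (32 * \<delta>)"
    using l ennreal_mult[of 16 "2 * \<delta>"] by simp
  finally show ?thesis .
qed

text \<open>Negative t run through the ray of \<open>- p\<close>, whence 32 + 32. The value t = 0,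
  where the direction of t p is lost, is excluded.\<close>

lemma nn_integral_angle_line:
  fixes p q :: "'a::euclidean_space"
  assumes p: "norm p \<ge> 1" and s: "s1 \<in> {-1, 1::real}" "s2 \<in> {-1, 1}" and l: "\<delta> \<ge> 0"
  shows "(\<integral>\<^sup>+t. ennreal ((vec_angle (s1 *\<^sub>R (t *\<^sub>R p)) (s2 *\<^sub>R (q - t *\<^sub>R p)))\<^sup>2)
      * indicator {t. t \<noteq> 0 \<and> \<bar>t\<bar> \<le> R \<and> \<bar>\<tau> - s1 * norm (t *\<^sub>R p) - s2 * norm (q - t *\<^sub>R p)\<bar> \<le> \<delta>} t \<partial>lborel)
    \<le> ennreal (64 * \<delta>)"
proof -
  define G where "G p t = ennreal ((vec_angle (s1 *\<^sub>R (t *\<^sub>R p)) (s2 *\<^sub>R (q - t *\<^sub>R p)))\<^sup>2)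
      * indicator {t. 0 < t \<and> t \<le> R \<and> \<bar>\<tau> - s1 * norm (t *\<^sub>R p) - s2 * norm (q - t *\<^sub>R p)\<bar> \<le> \<delta>} t" for p :: 'a and t
  have [measurable]: "G p \<in> borel_measurable borel" for p
    unfolding G_def by measurable
  have G: "(\<integral>\<^sup>+t. G p t \<partial>lborel) \<le> ennreal (32 * \<delta>)" if "norm p \<ge> 1" for p
    unfolding G_def by (rule nn_integral_angle_ray[OF that s l])
  have eq: "ennreal ((vec_angle (s1 *\<^sub>R (t *\<^sub>R p)) (s2 *\<^sub>R (q - t *\<^sub>R p)))\<^sup>2)
      * indicator {t. t \<noteq> 0 \<and> \<bar>t\<bar> \<le> R \<and> \<bar>\<tau> - s1 * norm (t *\<^sub>R p) - s2 * norm (q - t *\<^sub>R p)\<bar> \<le> \<delta>} t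
      = G p t + G (- p) (0 + (-1) * t)" for t
    by (auto simp: G_def indicator_def)
  have "(\<integral>\<^sup>+t. G p t + G (- p) (0 + (-1) * t) \<partial>lborel)
      = (\<integral>\<^sup>+t. G p t \<partial>lborel) + (\<integral>\<^sup>+t. G (- p) (0 + (-1) * t) \<partial>lborel)"
    by (rule nn_integral_add) measurable
  also have "(\<integral>\<^sup>+t. G (- p) (0 + (-1) * t) \<partial>lborel) = (\<integral>\<^sup>+t. G (- p) t \<partial>lborel)"
    using nn_integral_real_affine[of "G (- p)" "-1" 0] by simp
  also have "(\<integral>\<^sup>+t. G p t \<partial>lborel) + (\<integral>\<^sup>+t. G (- p) t \<partial>lborel) \<le> ennreal (32 * \<delta>) + ennreal (32 * \<delta>)"
    using p by (intro add_mono G) auto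
  also have "\<dots> = ennreal (64 * \<delta>)" using l by (simp flip: ennreal_plus)
  finally show ?thesis unfolding eq .
qed

section \<open>Slope coordinates in the plane\<close>

lemma Basis_real2: "(Basis :: (real^2) set) = {axis 1 1, axis 2 1}"
  by (auto simp: Basis_vec_def UNIV_2)

text \<open>A Borel measure that gives every box its volume is Lebesgue measure; identifying the
  plane with a product in this way makes Fubini in coordinates available.\<close>

lemma lborel_real2:
  "(lborel :: (real^2) measure) = distr (lborel \<Otimes>\<^sub>M lborel) borel (\<lambda>(x, y). x *\<^sub>R axis 1 1 + y *\<^sub>R axis 2 1)"
proof (rule lborel_eqI)
  fix l u :: "real^2"
  assume lu: "\<And>b. b \<in> Basis \<Longrightarrow> l \<bullet> b \<le> u \<bullet> b"
  have le: "l $ 1 \<le> u $ 1" "l $ 2 \<le> u $ 2"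
    using lu[of "axis 1 1"] lu[of "axis 2 1"] by (simp_all add: Basis_real2 inner_axis)
  have "(\<lambda>(x, y). x *\<^sub>R axis 1 1 + y *\<^sub>R axis 2 1 :: real^2) -` box l u = {l$1<..<u$1} \<times> {l$2<..<u$2}"
    by (auto simp: mem_box_cart forall_2 axis_def)
  then have "emeasure (distr (lborel \<Otimes>\<^sub>M lborel) borel (\<lambda>(x, y). x *\<^sub>R axis 1 1 + y *\<^sub>R axis 2 1)) (box l u)
      = emeasure (lborel \<Otimes>\<^sub>M lborel) ({l$1<..<u$1} \<times> {l$2<..<u$2})"
    by (subst emeasure_distr) (simp_all add: space_pair_measure)
  also have "\<dots> = emeasure lborel {l$1<..<u$1} * emeasure lborel {l$2<..<u$2}"
    by (intro lborel.emeasure_pair_measure_Times) auto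
  also have "\<dots> = (\<Prod>b\<in>Basis. (u - l) \<bullet> b)"
    using le by (simp add: Basis_real2 inner_axis axis_eq_axis ennreal_mult)
  finally show "emeasure (distr (lborel \<Otimes>\<^sub>M lborel) borel (\<lambda>(x, y). x *\<^sub>R axis 1 1 + y *\<^sub>R axis 2 1)) (box l u)
      = (\<Prod>b\<in>Basis. (u - l) \<bullet> b)" .
qed simp

text \<open>Either coordinate may be the outer one: it will serve as the radial variable, and the
  direction of the strip decides which of the two is suitable.\<close>

lemma nn_integral_real2:
  fixes F :: "real^2 \<Rightarrow> ennreal"
  assumes [measurable]: "F \<in> borel_measurable borel" and ij: "i \<noteq> (j::2)"
  shows "(\<integral>\<^sup>+\<xi>. F \<xi> \<partial>lborel) = (\<integral>\<^sup>+x. \<integral>\<^sup>+y. F (x *\<^sub>R axis i 1 + y *\<^sub>R axis j 1) \<partial>lborel \<partial>lborel)"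
proof -
  have 1: "(\<integral>\<^sup>+\<xi>. F \<xi> \<partial>lborel) = (\<integral>\<^sup>+z. F (fst z *\<^sub>R axis 1 1 + snd z *\<^sub>R axis 2 1) \<partial>(lborel \<Otimes>\<^sub>M lborel))"
    by (subst lborel_real2, subst nn_integral_distr) (auto simp: case_prod_beta)
  consider "i = 1" "j = 2" | "i = 2" "j = 1"
    using ij by (metis exhaust_2)
  then show ?thesis
  proof cases
    case 1
    then show ?thesis unfolding \<open>(\<integral>\<^sup>+\<xi>. F \<xi> \<partial>lborel) = _\<close>
      by (subst lborel.nn_integral_fst[symmetric]) auto
  next
    case 2
    then show ?thesis unfolding \<open>(\<integral>\<^sup>+\<xi>. F \<xi> \<partial>lborel) = _\<close>
      by (subst lborel_pair.nn_integral_snd[symmetric]) (auto simp: add.commute)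
  qed
qed

text \<open>The substitution y = x v turns the inner variable into the slope, with Jacobian |x| <=
  R. After exchanging the integrals each slope contributes a line through the origin, at most 64
  \<delta>, and the slopes fill an interval of length b - a.\<close>

lemma nn_integral_angle_sector:
  fixes q :: "real^2"
  assumes ij: "i \<noteq> (j::2)" and s: "s1 \<in> {-1, 1::real}" "s2 \<in> {-1, 1}" and l: "\<delta> \<ge> 0"
    and R: "R \<ge> 0" and ab: "a \<le> b"
  shows "(\<integral>\<^sup>+\<xi>. ennreal ((vec_angle (s1 *\<^sub>R \<xi>) (s2 *\<^sub>R (q - \<xi>)))\<^sup>2)
      * indicator {\<xi>. \<bar>\<tau> - s1 * norm \<xi> - s2 * norm (q - \<xi>)\<bar> \<le> \<delta>} \<xi>
      * indicator {\<xi>. \<xi> $ i \<noteq> 0 \<and> \<bar>\<xi> $ i\<bar> \<le> R \<and> a \<le> \<xi> $ j / \<xi> $ i \<and> \<xi> $ j / \<xi> $ i \<le> b} \<xi> \<partial>lborel)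
    \<le> ennreal (64 * R * (b - a) * \<delta>)"
proof -
  define E where "E \<xi> = ennreal ((vec_angle (s1 *\<^sub>R \<xi>) (s2 *\<^sub>R (q - \<xi>)))\<^sup>2)
      * indicator {\<xi>. \<bar>\<tau> - s1 * norm \<xi> - s2 * norm (q - \<xi>)\<bar> \<le> \<delta>} \<xi>" for \<xi>
  define F where "F \<xi> = E \<xi>
      * indicator {\<xi>. \<xi> $ i \<noteq> 0 \<and> \<bar>\<xi> $ i\<bar> \<le> R \<and> a \<le> \<xi> $ j / \<xi> $ i \<and> \<xi> $ j / \<xi> $ i \<le> b} \<xi>" for \<xi>
  have comp: "\<xi> $ k = \<xi> \<bullet> axis k 1" for \<xi> :: "real^2" and k
    by (simp add: inner_axis)
  have Em[measurable]: "E \<in> borel_measurable borel"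
    unfolding E_def by measurable
  have Fm[measurable]: "F \<in> borel_measurable borel"
    unfolding F_def comp by measurable
  \<comment> \<open>The direction of slope v. Its i-th component is 1, so x is the parameter along
    the line and \<open>norm (p v) \<ge> 1\<close>.\<close>
  define p where "p v = (axis i 1 + v *\<^sub>R axis j 1 :: real^2)" for v
  have pm[measurable]: "p \<in> borel_measurable borel"
    unfolding p_def by measurable
  have p1: "norm (p v) \<ge> 1" for v
    using component_le_norm_cart[of "p v" i] ij by (simp add: p_def axis_def)
  have "(\<integral>\<^sup>+\<xi>. F \<xi> \<partial>lborel) = (\<integral>\<^sup>+x. \<integral>\<^sup>+y. F (x *\<^sub>R axis i 1 + y *\<^sub>R axis j 1) \<partial>lborel \<partial>lborel)"
    by (rule nn_integral_real2[OF Fm ij])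
  also have "\<dots> \<le> (\<integral>\<^sup>+x. \<integral>\<^sup>+v. ennreal R * (E (x *\<^sub>R p v) * indicator {x. x \<noteq> 0 \<and> \<bar>x\<bar> \<le> R} x * indicator {a..b} v) \<partial>lborel \<partial>lborel)"
  proof (rule nn_integral_mono)
    fix x :: real
    show "(\<integral>\<^sup>+y. F (x *\<^sub>R axis i 1 + y *\<^sub>R axis j 1) \<partial>lborel)
        \<le> (\<integral>\<^sup>+v. ennreal R * (E (x *\<^sub>R p v) * indicator {x. x \<noteq> 0 \<and> \<bar>x\<bar> \<le> R} x * indicator {a..b} v) \<partial>lborel)"
    \<comment> \<open>The substitution needs x to be nonzero; outside this case the indicator in F
      vanishes.\<close>
    proof (cases "x \<noteq> 0 \<and> \<bar>x\<bar> \<le> R")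
      case True
      have "(\<integral>\<^sup>+y. F (x *\<^sub>R axis i 1 + y *\<^sub>R axis j 1) \<partial>lborel)
          = ennreal \<bar>x\<bar> * (\<integral>\<^sup>+v. F (x *\<^sub>R axis i 1 + (0 + x * v) *\<^sub>R axis j 1) \<partial>lborel)"
        using True by (intro nn_integral_real_affine) auto
      also have "(\<integral>\<^sup>+v. F (x *\<^sub>R axis i 1 + (0 + x * v) *\<^sub>R axis j 1) \<partial>lborel)
          = (\<integral>\<^sup>+v. E (x *\<^sub>R p v) * indicator {x. x \<noteq> 0 \<and> \<bar>x\<bar> \<le> R} x * indicator {a..b} v \<partial>lborel)"
      proof (rule nn_integral_cong)
        fix v
        have "x *\<^sub>R axis i 1 + (0 + x * v) *\<^sub>R axis j 1 = x *\<^sub>R p v"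
          by (simp add: p_def scaleR_add_right)
        moreover have "(x *\<^sub>R p v) $ i = x" "(x *\<^sub>R p v) $ j = x * v"
          using ij by (auto simp: p_def axis_def)
        ultimately show "F (x *\<^sub>R axis i 1 + (0 + x * v) *\<^sub>R axis j 1)
            = E (x *\<^sub>R p v) * indicator {x. x \<noteq> 0 \<and> \<bar>x\<bar> \<le> R} x * indicator {a..b} v"
          using True by (auto simp: F_def indicator_def)
      qed
      also have "ennreal \<bar>x\<bar> * \<dots> \<le> ennreal R * \<dots>"
        using True by (intro mult_right_mono ennreal_leI) auto
      also have "\<dots> = (\<integral>\<^sup>+v. ennreal R * (E (x *\<^sub>R p v) * indicator {x. x \<noteq> 0 \<and> \<bar>x\<bar> \<le> R} x * indicator {a..b} v) \<partial>lborel)"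
        by (rule nn_integral_cmult[symmetric]) measurable
      finally show ?thesis .
    next
      case False
      then have "F (x *\<^sub>R axis i 1 + y *\<^sub>R axis j 1) = 0" for y
        using ij by (auto simp: F_def axis_def)
      then show ?thesis by simp
    qed
  qed
  also have "\<dots> = (\<integral>\<^sup>+v. \<integral>\<^sup>+x. ennreal R * (E (x *\<^sub>R p v) * indicator {x. x \<noteq> 0 \<and> \<bar>x\<bar> \<le> R} x * indicator {a..b} v) \<partial>lborel \<partial>lborel)"
    by (rule lborel_pair.Fubini'[symmetric]) measurable
  also have "\<dots> \<le> (\<integral>\<^sup>+v. ennreal (R * (64 * \<delta>)) * indicator {a..b} v \<partial>lborel)"
  proof (rule nn_integral_mono)
    fix v
    have "(\<integral>\<^sup>+x. ennreal R * (E (x *\<^sub>R p v) * indicator {x. x \<noteq> 0 \<and> \<bar>x\<bar> \<le> R} x * indicator {a..b} v) \<partial>lborel)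
        = ennreal R * indicator {a..b} v * (\<integral>\<^sup>+x. E (x *\<^sub>R p v) * indicator {x. x \<noteq> 0 \<and> \<bar>x\<bar> \<le> R} x \<partial>lborel)"
      by (subst nn_integral_cmult[symmetric]) (auto simp: mult_ac)
    also have "\<dots> \<le> ennreal R * indicator {a..b} v * ennreal (64 * \<delta>)"
      by (intro mult_left_mono order_trans[OF _ nn_integral_angle_line[OF p1[of v] s l, of q R \<tau>]])
         (auto intro!: nn_integral_mono simp: E_def indicator_def)
    also have "\<dots> = ennreal (R * (64 * \<delta>)) * indicator {a..b} v"
      using R l by (simp add: ennreal_mult mult_ac)
    finally show "(\<integral>\<^sup>+x. ennreal R * (E (x *\<^sub>R p v) * indicator {x. x \<noteq> 0 \<and> \<bar>x\<bar> \<le> R} x * indicator {a..b} v) \<partial>lborel)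
        \<le> ennreal (R * (64 * \<delta>)) * indicator {a..b} v" .
  qed
  also have "\<dots> = ennreal (64 * R * (b - a) * \<delta>)"
    using R l ab by (simp add: nn_integral_cmult_indicator flip: ennreal_mult)
  finally show ?thesis unfolding F_def E_def .
qed

section \<open>The part of a strip inside an annulus, described by slopes\<close>

lemma cross_le_of_strip:
  fixes \<omega> \<xi> :: "real^2"
  assumes "norm \<omega> = 1" "\<xi> \<in> strip r \<omega>" "i \<noteq> (j::2)"
  shows "\<bar>\<xi> $ j * \<omega> $ i - \<xi> $ i * \<omega> $ j\<bar> \<le> r / 2"
proof -
  have "\<bar>\<xi> $ j * \<omega> $ i - \<xi> $ i * \<omega> $ j\<bar> \<le> infdist \<xi> (span {\<omega>})"
    unfolding infdist_notempty[of "span {\<omega>}", OF ex_in_conv[THEN iffD1, OF exI, OF span_zero]]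
  proof (rule cINF_greatest)
    show "span {\<omega>} \<noteq> {}" using span_zero by blast
    fix \<eta> assume "\<eta> \<in> span {\<omega>}"
    then obtain c where \<eta>: "\<eta> = c *\<^sub>R \<omega>" by (auto simp: span_singleton)
    define z where "z = \<xi> - \<eta>"
    \<comment> \<open>The expression is the inner product with \<omega> turned by a right angle, a
      unit vector orthogonal to the line; any point \<eta> of the line may therefore be subtracted
      from \<xi>.\<close>
    have "\<xi> $ j * \<omega> $ i - \<xi> $ i * \<omega> $ j = z \<bullet> (\<omega> $ i *\<^sub>R axis j 1 - \<omega> $ j *\<^sub>R axis i 1)"
      by (simp add: z_def \<eta> inner_axis inner_diff_right algebra_simps)
    also have "\<bar>\<dots>\<bar> \<le> norm z * norm (\<omega> $ i *\<^sub>R axis j 1 - \<omega> $ j *\<^sub>R axis i (1::real))"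
      by (rule Cauchy_Schwarz_ineq2)
    also have "norm (\<omega> $ i *\<^sub>R axis j 1 - \<omega> $ j *\<^sub>R axis i (1::real)) = norm \<omega>"
    proof -
      have "i = 1 \<and> j = 2 \<or> i = 2 \<and> j = 1" using assms(3) by (metis exhaust_2)
      then show ?thesis by (auto simp: norm_eq_sqrt_inner inner_vec_def sum_2 axis_def add.commute)
    qed
    finally show "\<bar>\<xi> $ j * \<omega> $ i - \<xi> $ i * \<omega> $ j\<bar> \<le> dist \<xi> \<eta>"
      using assms(1) by (simp add: z_def dist_norm)
  qed
  with assms(2) show ?thesis by (simp add: strip_def)
qed

lemma strip_measurable [measurable]: "strip r \<omega> \<in> sets borel"
  unfolding strip_def by (intro borel_closed closed_Collect_le continuous_intros)

lemma thick_cone_measurable [measurable]: "thick_cone M s N L \<in> sets borel"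
proof -
  have "thick_cone M s N L = {X. N / M \<le> norm (snd X) \<and> norm (snd X) \<le> M * N \<and> \<bar>fst X - s * norm (snd X)\<bar> \<le> M * L}"
    by (auto simp: thick_cone_def)
  moreover have "closed \<dots>"
    by (intro closed_Collect_conj closed_Collect_le continuous_intros)
  ultimately show ?thesis by simp
qed

text \<open>If N <= 4 M r, the strip need not restrict directions, and the two charts with slopes in
  [-1, 1] cover everything off the origin; their width 2 is paid for by that inequality. Otherwise
  the slopes lie within 4 M r / N of that of \<omega> and one sector suffices, which is listed twice
  to keep a single form of the conclusion.\<close>

lemma strip_annulus_subset:
  fixes \<omega> :: "real^2"
  assumes \<omega>: "norm \<omega> = 1" and N: "N > 0" and r: "r > 0" and M: "M \<ge> 1"
  shows "\<exists>i j i' j' a b a' b'. i \<noteq> (j::2) \<and> i' \<noteq> (j'::2) \<and> a \<le> b \<and> a' \<le> b' \<and> N * (b - a) \<le> 8 * M * r \<and> N * (b' - a') \<le> 8 * M * r \<and>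
    {\<xi>. N / M \<le> norm \<xi> \<and> norm \<xi> \<le> M * N \<and> \<xi> \<in> strip r \<omega>} \<subseteq>
      {\<xi>. \<xi> $ i \<noteq> 0 \<and> \<bar>\<xi> $ i\<bar> \<le> M * N \<and> a \<le> \<xi> $ j / \<xi> $ i \<and> \<xi> $ j / \<xi> $ i \<le> b} \<union>
      {\<xi>. \<xi> $ i' \<noteq> 0 \<and> \<bar>\<xi> $ i'\<bar> \<le> M * N \<and> a' \<le> \<xi> $ j' / \<xi> $ i' \<and> \<xi> $ j' / \<xi> $ i' \<le> b'}"
proof (cases "N \<le> 4 * M * r")
  case True
  have sub: "{\<xi>. N / M \<le> norm \<xi> \<and> norm \<xi> \<le> M * N \<and> \<xi> \<in> strip r \<omega>} \<subseteq>
      {\<xi>. \<xi> $ 1 \<noteq> 0 \<and> \<bar>\<xi> $ 1\<bar> \<le> M * N \<and> -1 \<le> \<xi> $ 2 / \<xi> $ 1 \<and> \<xi> $ 2 / \<xi> $ 1 \<le> 1} \<union>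
      {\<xi>. \<xi> $ 2 \<noteq> 0 \<and> \<bar>\<xi> $ 2\<bar> \<le> M * N \<and> -1 \<le> \<xi> $ 1 / \<xi> $ 2 \<and> \<xi> $ 1 / \<xi> $ 2 \<le> 1}"
  proof
    fix \<xi> :: "real^2" assume *: "\<xi> \<in> {\<xi>. N / M \<le> norm \<xi> \<and> norm \<xi> \<le> M * N \<and> \<xi> \<in> strip r \<omega>}"
    have "N / M > 0" using N M by simp
    then have "norm \<xi> > 0" using * by auto
    then have "\<xi> \<noteq> 0" by simp
    then have nz: "\<xi> $ 1 \<noteq> 0 \<or> \<xi> $ 2 \<noteq> 0"
      by (auto simp: vec_eq_iff forall_2)
    have le: "\<bar>\<xi> $ k\<bar> \<le> M * N" for k
      using component_le_norm_cart[of \<xi> k] * by auto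
    have q: "-1 \<le> y / x \<and> y / x \<le> 1" if "\<bar>y\<bar> \<le> \<bar>x\<bar>" for x y :: real
    proof -
      have "\<bar>y / x\<bar> \<le> 1" using that by (auto simp: abs_divide divide_le_eq_1)
      then show ?thesis by linarith
    qed
    show "\<xi> \<in> {\<xi>. \<xi> $ 1 \<noteq> 0 \<and> \<bar>\<xi> $ 1\<bar> \<le> M * N \<and> -1 \<le> \<xi> $ 2 / \<xi> $ 1 \<and> \<xi> $ 2 / \<xi> $ 1 \<le> 1} \<union>
      {\<xi>. \<xi> $ 2 \<noteq> 0 \<and> \<bar>\<xi> $ 2\<bar> \<le> M * N \<and> -1 \<le> \<xi> $ 1 / \<xi> $ 2 \<and> \<xi> $ 1 / \<xi> $ 2 \<le> 1}"
    proof (cases "\<bar>\<xi> $ 2\<bar> \<le> \<bar>\<xi> $ 1\<bar>")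
      case True
      then show ?thesis using nz le[of 1] q[OF True] by auto
    next
      case False
      then show ?thesis using nz le[of 2] q[of "\<xi> $ 1" "\<xi> $ 2"] by auto
    qed
  qed
  show ?thesis
    by (rule exI[of _ 1], rule exI[of _ 2], rule exI[of _ 2], rule exI[of _ 1],
        rule exI[of _ "-1"], rule exI[of _ 1], rule exI[of _ "-1"], rule exI[of _ 1])
       (use sub True in simp)
next
  case False
  \<comment> \<open>The index i is that of the dominant component of \<omega>: in this chart the
    slope of \<omega> is at most 1 in modulus, and the component itself is at least 1/2 in
    modulus.\<close>
  obtain i j :: 2 where ij: "i \<noteq> j" and ge: "\<bar>\<omega> $ j\<bar> \<le> \<bar>\<omega> $ i\<bar>"
  proof (cases "\<bar>\<omega> $ 2\<bar> \<le> \<bar>\<omega> $ 1\<bar>")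
    case True
    then show ?thesis by (intro that[of 1 2]) auto
  next
    case False
    then show ?thesis by (intro that[of 2 1]) auto
  qed
  have sq: "(norm v)\<^sup>2 = (v $ i)\<^sup>2 + (v $ j)\<^sup>2" for v :: "real^2"
  proof -
    have "i = 1 \<and> j = 2 \<or> i = 2 \<and> j = 1" using ij by (metis exhaust_2)
    then show ?thesis
      unfolding power2_norm_eq_inner by (auto simp: inner_vec_def sum_2 power2_eq_square add.commute)
  qed
  have "(\<omega> $ j)\<^sup>2 \<le> (\<omega> $ i)\<^sup>2" using ge by (simp add: abs_le_square_iff)
  then have "1 \<le> 2 * (\<omega> $ i)\<^sup>2" using sq[of \<omega>] \<omega> by simp
  then have "(1/2)\<^sup>2 \<le> (\<omega> $ i)\<^sup>2" by (simp add: power_divide)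
  then have wi: "1/2 \<le> \<bar>\<omega> $ i\<bar>" using abs_le_square_iff[of "1/2" "\<omega> $ i"] by simp
  define m where "m = \<omega> $ j / \<omega> $ i"
  have m1: "\<bar>m\<bar> \<le> 1" using ge wi by (simp add: m_def abs_divide divide_le_eq_1)
  \<comment> \<open>The admissible deviation of the slope: the coordinates deviate by at most r,
    while |x| is at least N / (4 M).\<close>
  define d where "d = 4 * M * r / N"
  have d: "d \<ge> 0" using N M r by (simp add: d_def)
  have sub: "{\<xi>. N / M \<le> norm \<xi> \<and> norm \<xi> \<le> M * N \<and> \<xi> \<in> strip r \<omega>} \<subseteq>
      {\<xi>. \<xi> $ i \<noteq> 0 \<and> \<bar>\<xi> $ i\<bar> \<le> M * N \<and> m - d \<le> \<xi> $ j / \<xi> $ i \<and> \<xi> $ j / \<xi> $ i \<le> m + d}"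
  proof
    fix \<xi> :: "real^2" assume *: "\<xi> \<in> {\<xi>. N / M \<le> norm \<xi> \<and> norm \<xi> \<le> M * N \<and> \<xi> \<in> strip r \<omega>}"
    let ?x = "\<xi> $ i" and ?y = "\<xi> $ j"
    have "\<bar>?y * \<omega> $ i - ?x * \<omega> $ j\<bar> \<le> r / 2"
      using * by (intro cross_le_of_strip[OF \<omega> _ ij]) auto
    also have "?y * \<omega> $ i - ?x * \<omega> $ j = \<omega> $ i * (?y - m * ?x)"
      using wi by (auto simp: m_def field_simps)
    finally have "\<bar>\<omega> $ i\<bar> * \<bar>?y - m * ?x\<bar> \<le> r / 2" by (simp add: abs_mult)
    moreover have "1/2 * \<bar>?y - m * ?x\<bar> \<le> \<bar>\<omega> $ i\<bar> * \<bar>?y - m * ?x\<bar>"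
      using wi by (intro mult_right_mono) auto
    \<comment> \<open>The half-width r / 2 of the strip loses a factor 2 through division by the
      dominant component.\<close>
    ultimately have dev: "\<bar>?y - m * ?x\<bar> \<le> r" by simp
    have "\<bar>m * ?x\<bar> \<le> \<bar>?x\<bar>" using m1 by (simp add: abs_mult mult_left_le_one_le)
    then have "\<bar>?y\<bar> \<le> \<bar>?x\<bar> + r" using dev by linarith
    moreover have "norm \<xi> \<le> \<bar>?x\<bar> + \<bar>?y\<bar>"
      by (rule power2_le_imp_le) (auto simp: sq power2_sum)
    ultimately have "N / M \<le> 2 * \<bar>?x\<bar> + r" using * by simp
    moreover have "r \<le> N / (4 * M)" using False M by (simp add: field_simps)
    moreover have "N / (4 * M) = (N / M) / 4" by simp
    moreover have "N / M > 0" using N M by simp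
    \<comment> \<open>Since r is at most a quarter of N / M, the inequality N / M <= 2 |x| + r
      leaves |x| >= 3/8 of N / M, more than the quarter claimed.\<close>
    ultimately have x: "N / (4 * M) \<le> \<bar>?x\<bar>" by linarith
    have x0: "?x \<noteq> 0" using x N M by (auto simp: field_simps)
    have "r = N / (4 * M) * d" using N M by (simp add: d_def)
    also have "\<dots> \<le> \<bar>?x\<bar> * d" using x d by (rule mult_right_mono)
    finally have "\<bar>?y - m * ?x\<bar> \<le> \<bar>?x\<bar> * d" using dev by linarith
    moreover have "?y - m * ?x = ?x * (?y / ?x - m)" using x0 by (simp add: field_simps)
    ultimately have "\<bar>?y / ?x - m\<bar> \<le> d" using x0 by (simp add: abs_mult)
    moreover have "\<bar>?x\<bar> \<le> M * N"
      using component_le_norm_cart[of \<xi> i] * by auto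
    ultimately show "\<xi> \<in> {\<xi>. \<xi> $ i \<noteq> 0 \<and> \<bar>\<xi> $ i\<bar> \<le> M * N \<and> m - d \<le> \<xi> $ j / \<xi> $ i \<and> \<xi> $ j / \<xi> $ i \<le> m + d}"
      using x0 by auto
  qed
  have width: "N * ((m + d) - (m - d)) \<le> 8 * M * r" using N by (simp add: d_def)
  show ?thesis
    by (rule exI[of _ i], rule exI[of _ j], rule exI[of _ i], rule exI[of _ j],
        rule exI[of _ "m - d"], rule exI[of _ "m + d"], rule exI[of _ "m - d"], rule exI[of _ "m + d"])
       (use sub ij d width in auto)
qed

section \<open>Integrals of the squared angle over the strip and over the cones\<close>

proposition nn_integral_angle_strip:
  fixes q \<omega> :: "real^2"
  assumes \<omega>: "norm \<omega> = 1" and N: "N > 0" and r: "r > 0" and M: "M \<ge> 1"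
    and s: "s1 \<in> {-1, 1::real}" "s2 \<in> {-1, 1}" and l: "\<delta> \<ge> 0"
  shows "(\<integral>\<^sup>+\<xi>. ennreal ((vec_angle (s1 *\<^sub>R \<xi>) (s2 *\<^sub>R (q - \<xi>)))\<^sup>2)
      * indicator {\<xi>. \<bar>\<tau> - s1 * norm \<xi> - s2 * norm (q - \<xi>)\<bar> \<le> \<delta>} \<xi>
      * indicator {\<xi>. N / M \<le> norm \<xi> \<and> norm \<xi> \<le> M * N \<and> \<xi> \<in> strip r \<omega>} \<xi> \<partial>lborel)
    \<le> ennreal (1024 * M\<^sup>2 * r * \<delta>)"
proof -
  define E where "E \<xi> = ennreal ((vec_angle (s1 *\<^sub>R \<xi>) (s2 *\<^sub>R (q - \<xi>)))\<^sup>2)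
      * indicator {\<xi>. \<bar>\<tau> - s1 * norm \<xi> - s2 * norm (q - \<xi>)\<bar> \<le> \<delta>} \<xi>" for \<xi>
  have Em[measurable]: "E \<in> borel_measurable borel"
    unfolding E_def by measurable
  define Q where "Q i j a b = {\<xi>::real^2. \<xi> $ i \<noteq> 0 \<and> \<bar>\<xi> $ i\<bar> \<le> M * N \<and> a \<le> \<xi> $ j / \<xi> $ i \<and> \<xi> $ j / \<xi> $ i \<le> b}"
    for i j :: 2 and a b
  have comp: "\<xi> $ k = \<xi> \<bullet> axis k 1" for \<xi> :: "real^2" and k
    by (simp add: inner_axis)
  have [measurable]: "Q i j a b \<in> sets borel" for i j a b
    unfolding Q_def comp by measurable
  have MN: "M * N \<ge> 0" using N M by simp
  \<comment> \<open>The Jacobian bound M N meets a sector of width at most 8 M r / N, so N cancels;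
    64 * 8 = 512 for each of the two sectors.\<close>
  have sector: "(\<integral>\<^sup>+\<xi>. E \<xi> * indicator (Q i j a b) \<xi> \<partial>lborel) \<le> ennreal (512 * M\<^sup>2 * r * \<delta>)"
    if "i \<noteq> j" "a \<le> b" "N * (b - a) \<le> 8 * M * r" for i j a b
  proof -
    have "(\<integral>\<^sup>+\<xi>. E \<xi> * indicator (Q i j a b) \<xi> \<partial>lborel) \<le> ennreal (64 * (M * N) * (b - a) * \<delta>)"
      unfolding E_def Q_def by (rule nn_integral_angle_sector[OF that(1) s l MN that(2)])
    also have "64 * (M * N) * (b - a) * \<delta> = 64 * M * \<delta> * (N * (b - a))" by simp
    also have "\<dots> \<le> 64 * M * \<delta> * (8 * M * r)"
      using that(3) M l by (intro mult_left_mono) auto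
    also have "\<dots> = 512 * M\<^sup>2 * r * \<delta>" by (simp add: power2_eq_square)
    finally show ?thesis by (simp add: ennreal_leI)
  qed
  obtain i j i' j' a b a' b' where
    *: "i \<noteq> j" "a \<le> b" "N * (b - a) \<le> 8 * M * r" "i' \<noteq> j'" "a' \<le> b'" "N * (b' - a') \<le> 8 * M * r"
    and sub: "{\<xi>. N / M \<le> norm \<xi> \<and> norm \<xi> \<le> M * N \<and> \<xi> \<in> strip r \<omega>} \<subseteq> Q i j a b \<union> Q i' j' a' b'"
    using strip_annulus_subset[OF \<omega> N r M] unfolding Q_def by blast
  have "(\<integral>\<^sup>+\<xi>. E \<xi> * indicator {\<xi>. N / M \<le> norm \<xi> \<and> norm \<xi> \<le> M * N \<and> \<xi> \<in> strip r \<omega>} \<xi> \<partial>lborel)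
      \<le> (\<integral>\<^sup>+\<xi>. E \<xi> * indicator (Q i j a b) \<xi> + E \<xi> * indicator (Q i' j' a' b') \<xi> \<partial>lborel)"
    using sub by (intro nn_integral_mono) (auto simp: indicator_def)
  also have "\<dots> = (\<integral>\<^sup>+\<xi>. E \<xi> * indicator (Q i j a b) \<xi> \<partial>lborel) + (\<integral>\<^sup>+\<xi>. E \<xi> * indicator (Q i' j' a' b') \<xi> \<partial>lborel)"
    by (rule nn_integral_add) measurable
  also have "\<dots> \<le> ennreal (512 * M\<^sup>2 * r * \<delta>) + ennreal (512 * M\<^sup>2 * r * \<delta>)"
    using * by (intro add_mono sector)
  also have "\<dots> = ennreal (1024 * M\<^sup>2 * r * \<delta>)"
    using r l by (simp flip: ennreal_plus)
  finally show ?thesis unfolding E_def .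
qed

text \<open>For fixed \<xi> the admissible \<tau>1 lie in two intervals of lengths 2 M L1 and 2 M
  L2. The shorter one bounds their measure, and a common point puts the phase within M (L1 + L2) of
  \<tau>. The constant is 1024 * 2 * 2.\<close>

proposition nn_integral_angle_cones:
  fixes \<omega> :: "real^2"
  assumes \<omega>: "norm \<omega> = 1" and N: "N1 > 0" and r: "r > 0" and M: "M \<ge> 1"
    and s: "s1 \<in> {-1, 1::real}" "s2 \<in> {-1, 1}" and L: "L1 > 0" "L2 > 0"
  shows "(\<integral>\<^sup>+X1. ennreal ((vec_angle (s1 *\<^sub>R snd X1) (s2 *\<^sub>R snd (X0 - X1)))\<^sup>2)
      * indicator (thick_cone M s1 N1 L1 \<inter> UNIV \<times> strip r \<omega>) X1
      * indicator (thick_cone M s2 N2 L2) (X0 - X1) \<partial>lborel)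
    \<le> ennreal (4096 * M^4 * (r * L1 * L2))"
proof -
  obtain \<tau> q where X0: "X0 = (\<tau>, q)" by (cases X0)
  define m where "m = min L1 L2"
  \<comment> \<open>This dominates M L1 + M L2; in terms of the maximum rather than the sum, the
    product with the minimum \<open>m\<close> is exactly a multiple of L1 L2.\<close>
  define \<delta> where "\<delta> = 2 * M * max L1 L2"
  have l: "\<delta> \<ge> 0" using L M by (simp add: \<delta>_def)
  define A where "A \<xi> = ennreal ((vec_angle (s1 *\<^sub>R \<xi>) (s2 *\<^sub>R (q - \<xi>)))\<^sup>2)
      * indicator {\<xi>. \<bar>\<tau> - s1 * norm \<xi> - s2 * norm (q - \<xi>)\<bar> \<le> \<delta>} \<xi>
      * indicator {\<xi>. N1 / M \<le> norm \<xi> \<and> norm \<xi> \<le> M * N1 \<and> \<xi> \<in> strip r \<omega>} \<xi>" for \<xi>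
  define T where "T \<xi> = {\<tau>1. \<bar>\<tau>1 - s1 * norm \<xi>\<bar> \<le> M * L1 \<and> \<bar>\<tau> - \<tau>1 - s2 * norm (q - \<xi>)\<bar> \<le> M * L2}" for \<xi>
  define F where "F X1 = ennreal ((vec_angle (s1 *\<^sub>R snd X1) (s2 *\<^sub>R snd (X0 - X1)))\<^sup>2)
      * indicator (thick_cone M s1 N1 L1 \<inter> UNIV \<times> strip r \<omega>) X1
      * indicator (thick_cone M s2 N2 L2) (X0 - X1)" for X1
  have [measurable]: "UNIV \<times> strip r \<omega> \<in> sets (borel :: spacetime measure)"
    by (simp add: borel_prod[symmetric])
  have "(\<lambda>X. snd (X0 - X)) \<in> borel_measurable borel" "(\<lambda>X. snd X) \<in> borel_measurable (borel :: spacetime measure)"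
    by (intro borel_measurable_continuous_onI continuous_intros)+
  then have Fm: "F \<in> borel_measurable borel"
    unfolding F_def
    by (intro borel_measurable_times_ennreal measurable_compose[OF _ measurable_ennreal] borel_measurable_power
        vec_angle_measurable borel_measurable_scaleR borel_measurable_const borel_measurable_indicator
        borel_measurable_indicator' sets.Int) simp_all
  have Am: "A \<in> borel_measurable borel"
    unfolding A_def by measurable
  have "(\<integral>\<^sup>+X1. F X1 \<partial>lborel) = (\<integral>\<^sup>+\<xi>. \<integral>\<^sup>+\<tau>1. F (\<tau>1, \<xi>) \<partial>lborel \<partial>lborel)"
    using Fm by (subst lborel_pair.nn_integral_snd) (simp_all add: lborel_prod)
  also have "\<dots> \<le> (\<integral>\<^sup>+\<xi>. A \<xi> * ennreal (2 * M * m) \<partial>lborel)"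
  proof (rule nn_integral_mono)
    fix \<xi>
    have Tm[measurable]: "T \<xi> \<in> sets borel"
      unfolding T_def by measurable
    have "(\<integral>\<^sup>+\<tau>1. F (\<tau>1, \<xi>) \<partial>lborel) \<le> (\<integral>\<^sup>+\<tau>1. A \<xi> * indicator (T \<xi>) \<tau>1 \<partial>lborel)"
    proof (rule nn_integral_mono)
      fix \<tau>1
      have "\<bar>\<tau> - s1 * norm \<xi> - s2 * norm (q - \<xi>)\<bar> \<le> \<delta>" if "\<tau>1 \<in> T \<xi>"
      proof -
        have "\<bar>\<tau> - s1 * norm \<xi> - s2 * norm (q - \<xi>)\<bar> \<le> M * L1 + M * L2"
          using that by (auto simp: T_def)
        also have "\<dots> \<le> M * max L1 L2 + M * max L1 L2"
          using M by (intro add_mono mult_left_mono) auto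
        finally show ?thesis by (simp add: \<delta>_def)
      qed
      then show "F (\<tau>1, \<xi>) \<le> A \<xi> * indicator (T \<xi>) \<tau>1"
        by (auto simp: F_def A_def X0 T_def thick_cone_def indicator_def)
    qed
    also have "\<dots> = A \<xi> * emeasure lborel (T \<xi>)"
      by (rule nn_integral_cmult_indicator) simp
    also have "emeasure lborel (T \<xi>) \<le> ennreal (2 * M * m)"
    proof (cases "L1 \<le> L2")
      case True
      have "emeasure lborel (T \<xi>) \<le> emeasure lborel {s1 * norm \<xi> - M * L1 .. s1 * norm \<xi> + M * L1}"
        by (intro emeasure_mono) (auto simp: T_def)
      also have "\<dots> = ennreal (2 * M * m)" using True L M by (simp add: m_def)
      finally show ?thesis .
    next
      case False
      have "emeasure lborel (T \<xi>) \<le> emeasure lborel {\<tau> - s2 * norm (q - \<xi>) - M * L2 .. \<tau> - s2 * norm (q - \<xi>) + M * L2}"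
        by (intro emeasure_mono) (auto simp: T_def)
      also have "\<dots> = ennreal (2 * M * m)" using False L M by (simp add: m_def)
      finally show ?thesis .
    qed
    finally show "(\<integral>\<^sup>+\<tau>1. F (\<tau>1, \<xi>) \<partial>lborel) \<le> A \<xi> * ennreal (2 * M * m)"
      by (simp add: mult_left_mono)
  qed
  also have "\<dots> = (\<integral>\<^sup>+\<xi>. A \<xi> \<partial>lborel) * ennreal (2 * M * m)"
    by (rule nn_integral_multc) (simp add: Am)
  also have "\<dots> \<le> ennreal (1024 * M\<^sup>2 * r * \<delta>) * ennreal (2 * M * m)"
    unfolding A_def by (intro mult_right_mono nn_integral_angle_strip[OF \<omega> N r M s l]) simp
  also have "\<dots> = ennreal (1024 * M\<^sup>2 * r * \<delta> * (2 * M * m))"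
    using r l M L by (intro ennreal_mult[symmetric]) (auto simp: m_def)
  also have "1024 * M\<^sup>2 * r * \<delta> * (2 * M * m) = 4096 * M^4 * (r * (max L1 L2 * min L1 L2))"
    by (simp add: \<delta>_def m_def power2_eq_square power4_eq_xxxx)
  also have "max L1 L2 * min L1 L2 = L1 * L2" by (auto simp: max_def min_def)
  finally show ?thesis unfolding F_def by (simp add: mult_ac)
qed

section \<open>The bilinear estimate\<close>

text \<open>The complement of the essential support is a union of possibly uncountably many open
  sets, each with its own exceptional null set. Lindelof's theorem reduces it to countably
  many.\<close>

lemma AE_zero_outside_ess_supp:
  fixes v :: "'a::euclidean_space \<Rightarrow> complex"
  assumes "ess_supp v \<subseteq> K"
  shows "AE X in lborel. X \<notin> K \<longrightarrow> v X = 0"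
proof -
  let ?U = "{U. open U \<and> (AE X in lborel. X \<in> U \<longrightarrow> v X = 0)}"
  obtain F where F: "F \<subseteq> ?U" "countable F" "\<Union>F = \<Union>?U"
    by (rule Lindelof[of ?U]) auto
  have "AE X in lborel. \<forall>U\<in>F. X \<in> U \<longrightarrow> v X = 0"
    using F(1,2) by (subst AE_ball_countable) auto
  then show ?thesis
  proof eventually_elim
    case (elim X)
    show ?case
    proof
      assume "X \<notin> K"
      then have "X \<in> \<Union>?U" using assms by (auto simp: ess_supp_def)
      then show "v X = 0" using elim F(3) by blast
    qed
  qed
qed

text \<open>The cut off transform is again in L2, hence by \<open>fourier_surj\<close> the transform
  of some function, and the choice defining the projection has a witness.\<close>

lemma fourier_proj:
  fixes u :: "'a::euclidean_space \<Rightarrow> complex"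
  assumes u: "u \<in> L2_space" and A: "A \<in> sets borel"
  shows "fourier_proj A u \<in> L2_space"
    and "AE X in lborel. fourier (fourier_proj A u) X = indicator A X * fourier u X"
proof -
  obtain v where "v \<in> L2_space" "AE X in lborel. fourier v X = indicator A X * fourier u X"
    by (rule fourier_surj[OF L2_space_indicator[OF fourier_L2[OF u] A]])
  then have "\<exists>v. v \<in> L2_space \<and> (AE X in lborel. fourier v X = indicator A X * fourier u X)"
    by blast
  from someI_ex[OF this]
  show "fourier_proj A u \<in> L2_space"
    "AE X in lborel. fourier (fourier_proj A u) X = indicator A X * fourier u X"
    by (simp_all add: fourier_proj_def)
qed

lemma distr_lborel_reflect:
  fixes X0 :: "'a::euclidean_space"
  shows "distr lborel borel (\<lambda>X. X0 - X) = lborel"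
  using lborel_affine[of "-1" X0] by (simp add: density_1)

text \<open>Reflection preserves null sets, so changing a representative is harmless in the argument
  X0 - X1 for every X0, not merely for almost every one.\<close>

lemma AE_lborel_reflect:
  fixes X0 :: "'a::euclidean_space"
  assumes "AE X in lborel. P X"
  shows "AE X in lborel. P (X0 - X)"
proof -
  have "AE X in distr lborel borel (\<lambda>X. X0 - X). P X"
    unfolding distr_lborel_reflect by (rule assms)
  then show ?thesis
    by (rule AE_distrD[rotated]) measurable
qed

lemma nn_integral_lborel_translate:
  fixes f :: "'a::euclidean_space \<Rightarrow> ennreal"
  assumes [measurable]: "f \<in> borel_measurable borel"
  shows "(\<integral>\<^sup>+X. f (X - a) \<partial>lborel) = (\<integral>\<^sup>+X. f X \<partial>lborel)"
  using nn_integral_lborel_affine[of f 1 "- a"] by simp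

text \<open>What Cauchy-Schwarz leaves beside the kernel is H, the convolution of |f1|^2 and |f2|^2,
  whose integral is the product of the squared norms. Its finiteness almost everywhere also gives
  the absolute convergence of the bilinear integral.\<close>

lemma L2_bilinear_bound:
  fixes f1 f2 :: "'a::euclidean_space \<Rightarrow> complex" and k :: "'a \<Rightarrow> 'a \<Rightarrow> real"
  assumes f1: "f1 \<in> L2_space" and f2: "f2 \<in> L2_space"
    and k[measurable]: "(\<lambda>(X0, X1). k X0 X1) \<in> borel_measurable (borel \<Otimes>\<^sub>M borel)"
    and K1[measurable]: "K1 \<in> sets borel" and K2[measurable]: "K2 \<in> sets borel"
    and s1: "\<And>X. X \<notin> K1 \<Longrightarrow> f1 X = 0" and s2: "\<And>X. X \<notin> K2 \<Longrightarrow> f2 X = 0"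
    and B: "B \<ge> 0" and bound: "\<And>X0. (\<integral>\<^sup>+X1. ennreal ((k X0 X1)\<^sup>2) * indicator K1 X1 * indicator K2 (X0 - X1) \<partial>lborel)
      \<le> ennreal (B\<^sup>2)"
  defines "g \<equiv> \<lambda>X0 X1. complex_of_real (k X0 X1) * f1 X1 * f2 (X0 - X1)"
  shows "AE X0 in lborel. integrable lborel (g X0)"
    and "(\<lambda>X0. \<integral>X1. g X0 X1 \<partial>lborel) \<in> L2_space"
    and "L2_norm (\<lambda>X0. \<integral>X1. g X0 X1 \<partial>lborel) \<le> B * L2_norm f1 * L2_norm f2"
proof -
  note [measurable] = L2_spaceD(1)[OF f1] L2_spaceD(1)[OF f2]
  have km[measurable]: "k X0 \<in> borel_measurable borel" for X0
    using measurable_Pair2[OF k, of X0] by simp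
  have gm: "(\<lambda>(X0, X1). g X0 X1) \<in> borel_measurable (borel \<Otimes>\<^sub>M borel)"
    unfolding g_def by measurable
  have gm1[measurable]: "g X0 \<in> borel_measurable borel" for X0
    using measurable_Pair2[OF gm, of X0] by simp
  define H where "H X0 = (\<integral>\<^sup>+X1. ennreal ((cmod (f1 X1))\<^sup>2) * ennreal ((cmod (f2 (X0 - X1)))\<^sup>2) \<partial>lborel)" for X0
  have [measurable]: "H \<in> borel_measurable borel"
    unfolding H_def by measurable
  have Hint: "(\<integral>\<^sup>+X0. H X0 \<partial>lborel) = ennreal ((L2_norm f1 * L2_norm f2)\<^sup>2)"
  proof -
    have "(\<integral>\<^sup>+X0. H X0 \<partial>lborel)
        = (\<integral>\<^sup>+X1. \<integral>\<^sup>+X0. ennreal ((cmod (f1 X1))\<^sup>2) * ennreal ((cmod (f2 (X0 - X1)))\<^sup>2) \<partial>lborel \<partial>lborel)"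
      unfolding H_def by (rule lborel_pair.Fubini') measurable
    also have "\<dots> = (\<integral>\<^sup>+X1. ennreal ((cmod (f1 X1))\<^sup>2) * ennreal ((L2_norm f2)\<^sup>2) \<partial>lborel)"
      using nn_integral_lborel_translate[of "\<lambda>X. ennreal ((cmod (f2 X))\<^sup>2)"]
      by (intro nn_integral_cong) (simp add: nn_integral_cmult nn_integral_L2[OF f2])
    also have "\<dots> = ennreal ((L2_norm f1 * L2_norm f2)\<^sup>2)"
      by (simp add: nn_integral_multc nn_integral_L2[OF f1] power_mult_distrib ennreal_mult)
    finally show ?thesis .
  qed
  have CS: "(\<integral>\<^sup>+X1. ennreal (cmod (g X0 X1)) \<partial>lborel)\<^sup>2 \<le> ennreal (B\<^sup>2) * H X0" for X0
  proof -
    \<comment> \<open>The indicators can be inserted because \<open>f1\<close> and \<open>f2\<close>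
      vanish at every point outside \<open>K1\<close> and \<open>K2\<close>.\<close>
    let ?a = "\<lambda>X1. ennreal \<bar>k X0 X1\<bar> * (indicator K1 X1 * indicator K2 (X0 - X1))"
    let ?b = "\<lambda>X1. ennreal (cmod (f1 X1)) * ennreal (cmod (f2 (X0 - X1)))"
    have "ennreal (cmod (g X0 X1)) = ?a X1 * ?b X1" for X1
      using s1[of X1] s2[of "X0 - X1"]
      by (auto simp: g_def norm_mult ennreal_mult indicator_def mult_ac)
    then have "(\<integral>\<^sup>+X1. ennreal (cmod (g X0 X1)) \<partial>lborel)\<^sup>2 = (\<integral>\<^sup>+X1. ?a X1 * ?b X1 \<partial>lborel)\<^sup>2"
      by simp
    also have "\<dots> \<le> (\<integral>\<^sup>+X1. (?a X1)\<^sup>2 \<partial>lborel) * (\<integral>\<^sup>+X1. (?b X1)\<^sup>2 \<partial>lborel)"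
      by (rule Cauchy_Schwarz_nn_integral) measurable
    also have "(\<integral>\<^sup>+X1. (?a X1)\<^sup>2 \<partial>lborel)
        = (\<integral>\<^sup>+X1. ennreal ((k X0 X1)\<^sup>2) * indicator K1 X1 * indicator K2 (X0 - X1) \<partial>lborel)"
      by (intro nn_integral_cong) (auto simp: indicator_def ennreal_power)
    also have "(\<integral>\<^sup>+X1. (?b X1)\<^sup>2 \<partial>lborel) = H X0"
      unfolding H_def by (intro nn_integral_cong) (simp add: power_mult_distrib ennreal_power)
    finally show ?thesis
      by (rule order_trans) (rule mult_right_mono[OF bound], simp)
  qed
  have "AE X0 in lborel. H X0 \<noteq> \<infinity>"
    by (rule nn_integral_PInf_AE) (simp_all add: Hint)
  then show "AE X0 in lborel. integrable lborel (g X0)"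
  proof eventually_elim
    case (elim X0)
    then have "ennreal (B\<^sup>2) * H X0 < \<infinity>"
      by (simp add: ennreal_mult_less_top less_top)
    with CS[of X0] have "(\<integral>\<^sup>+X1. ennreal (cmod (g X0 X1)) \<partial>lborel)\<^sup>2 < \<infinity>"
      by (rule le_less_trans)
    then have "(\<integral>\<^sup>+X1. ennreal (cmod (g X0 X1)) \<partial>lborel) < \<infinity>"
      by (simp add: power_less_top_ennreal)
    then show ?case by (simp add: integrable_iff_bounded)
  qed
  define W where "W = (\<lambda>X0. \<integral>X1. g X0 X1 \<partial>lborel)"
  have [measurable]: "W \<in> borel_measurable borel"
    unfolding W_def using gm
    by (intro lborel.borel_measurable_lebesgue_integral) (simp add: measurable_cong_sets[OF sets_pair_measure_cong[OF refl sets_lborel] refl])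
  have "(\<integral>\<^sup>+X0. ennreal ((cmod (W X0))\<^sup>2) \<partial>lborel) \<le> (\<integral>\<^sup>+X0. ennreal (B\<^sup>2) * H X0 \<partial>lborel)"
  proof (rule nn_integral_mono)
    fix X0
    have "ennreal ((cmod (W X0))\<^sup>2) = (ennreal (cmod (W X0)))\<^sup>2" by (simp add: ennreal_power)
    also have "\<dots> \<le> (\<integral>\<^sup>+X1. ennreal (cmod (g X0 X1)) \<partial>lborel)\<^sup>2"
    proof (rule power_mono)
      show "ennreal (cmod (W X0)) \<le> (\<integral>\<^sup>+X1. ennreal (cmod (g X0 X1)) \<partial>lborel)"
        unfolding W_def
        \<comment> \<open>Where \<open>g X0\<close> is not integrable the integral is 0 by default
          and the bound is trivial, so it holds at every X0.\<close>
        by (cases "integrable lborel (g X0)") (auto simp: integral_norm_bound_ennreal not_integrable_integral_eq)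
    qed simp
    finally show "ennreal ((cmod (W X0))\<^sup>2) \<le> ennreal (B\<^sup>2) * H X0" using CS[of X0] by (rule order_trans)
  qed
  also have "\<dots> = ennreal (B\<^sup>2) * ennreal ((L2_norm f1 * L2_norm f2)\<^sup>2)"
    by (simp add: nn_integral_cmult Hint)
  also have "\<dots> = ennreal ((B * L2_norm f1 * L2_norm f2)\<^sup>2)"
    by (simp add: power_mult_distrib ennreal_mult mult_ac)
  finally have le: "(\<integral>\<^sup>+X0. ennreal ((cmod (W X0))\<^sup>2) \<partial>lborel) \<le> ennreal ((B * L2_norm f1 * L2_norm f2)\<^sup>2)" .
  have "0 \<le> B * L2_norm f1 * L2_norm f2" using B by simp
  from L2_norm_le_nn[OF _ le this]
  show "(\<lambda>X0. \<integral>X1. g X0 X1 \<partial>lborel) \<in> L2_space"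
    and "L2_norm (\<lambda>X0. \<integral>X1. g X0 X1 \<partial>lborel) \<le> B * L2_norm f1 * L2_norm f2"
    unfolding W_def[symmetric] by simp_all
qed

lemma L2_norm_indicator_le:
  fixes u :: "'a::euclidean_space \<Rightarrow> complex"
  assumes u: "u \<in> L2_space" and A: "A \<in> sets borel"
  shows "L2_norm (\<lambda>x. indicator A x * u x) \<le> L2_norm u"
proof -
  have "(L2_norm (\<lambda>x. indicator A x * u x))\<^sup>2 \<le> (L2_norm u)\<^sup>2"
    unfolding L2_norm_sq
    using L2_spaceD(2)[OF u] L2_spaceD(2)[OF L2_space_indicator[OF u A]]
    by (intro integral_mono) (auto simp: indicator_def)
  then show ?thesis by (rule power2_le_imp_le) simp
qed

text \<open>The factor 64 M^2 is the square root of 4096 M^4. Plancherel for \<open>u1\<close> and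
  \<open>u2\<close> produces (2 pi)^(3/2) twice and Plancherel for \<open>w\<close> removes it once,
  so it survives to the first power.\<close>

theorem null_form_estimate:
  fixes u1 u2 :: "spacetime \<Rightarrow> complex"
  assumes M: "M \<ge> 1" and N: "N1 > 0" and L: "L1 > 0" "L2 > 0"
    and s: "s1 \<in> {-1, 1}" "s2 \<in> {-1, 1}" and r: "r > 0" and \<omega>: "norm \<omega> = 1"
    and u: "u1 \<in> L2_space" "u2 \<in> L2_space"
    and supp: "ess_supp (fourier u1) \<subseteq> thick_cone M s1 N1 L1" "ess_supp (fourier u2) \<subseteq> thick_cone M s2 N2 L2"
  defines "v1 \<equiv> fourier_proj (UNIV \<times> strip r \<omega>) u1"
  defines "w \<equiv> null_form s1 s2 v1 u2"
  shows "is_null_form s1 s2 v1 u2 w"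
    and "L2_norm w \<le> 64 * M\<^sup>2 * sqrt (2 * pi) ^ 3 * sqrt (r * L1 * L2) * L2_norm u1 * L2_norm u2"
proof -
  define K where "K = sqrt (2 * pi) ^ 3"
  have K: "K > 0" by (simp add: K_def)
  have DIM: "DIM(spacetime) = 3" by simp
  note norm_fourier = L2_norm_fourier[where 'a=spacetime, unfolded DIM, folded K_def]
  have strip[measurable]: "UNIV \<times> strip r \<omega> \<in> sets (borel :: spacetime measure)"
    by (simp add: borel_prod[symmetric])
  define K1 where "K1 = thick_cone M s1 N1 L1 \<inter> UNIV \<times> strip r \<omega>"
  define K2 where "K2 = thick_cone M s2 N2 L2"
  have Km: "K1 \<in> sets borel" "K2 \<in> sets borel" by (auto simp: K1_def K2_def)
  \<comment> \<open>Since \<open>K1\<close> contains the strip condition, this represents the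
    transform of the projection \<open>v1\<close>, yet it is cut out of the transform of
    \<open>u1\<close>, so its norm is compared with that of \<open>u1\<close> directly.\<close>
  define f1 where "f1 = (\<lambda>X. indicator K1 X * fourier u1 X)"
  define f2 where "f2 = (\<lambda>X. indicator K2 X * fourier u2 X)"
  have fL: "f1 \<in> L2_space" "f2 \<in> L2_space"
    unfolding f1_def f2_def by (intro L2_space_indicator fourier_L2 u Km)+
  have nf: "L2_norm f1 \<le> K * L2_norm u1" "L2_norm f2 \<le> K * L2_norm u2"
    unfolding f1_def f2_def norm_fourier[OF u(1), symmetric] norm_fourier[OF u(2), symmetric]
    by (intro L2_norm_indicator_le fourier_L2 u Km)+
  have v1L: "v1 \<in> L2_space"
    unfolding v1_def by (rule fourier_proj(1)[OF u(1) strip])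
  have f1_eq: "AE X in lborel. fourier v1 X = f1 X"
    using fourier_proj(2)[OF u(1) strip, folded v1_def] AE_zero_outside_ess_supp[OF supp(1)]
    by eventually_elim (auto simp: f1_def K1_def indicator_def)
  have f2_eq: "AE X in lborel. fourier u2 X = f2 X"
    using AE_zero_outside_ess_supp[OF supp(2)]
    by eventually_elim (auto simp: f2_def K2_def indicator_def)
  define k where "k X0 X1 = vec_angle (s1 *\<^sub>R snd X1) (s2 *\<^sub>R snd (X0 - X1))" for X0 X1 :: spacetime
  define g where "g X0 X1 = complex_of_real (k X0 X1) * f1 X1 * f2 (X0 - X1)" for X0 X1
  define B where "B = 64 * M\<^sup>2 * sqrt (r * L1 * L2)"
  have B: "B \<ge> 0" "B\<^sup>2 = 4096 * M^4 * (r * L1 * L2)"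
    using r L by (simp_all add: B_def power_mult_distrib)
  have sndm: "(snd :: spacetime \<Rightarrow> _) \<in> borel_measurable borel"
    by (intro borel_measurable_continuous_onI continuous_intros)
  have km: "(\<lambda>(X0, X1). k X0 X1) \<in> borel_measurable (borel \<Otimes>\<^sub>M borel)"
    unfolding k_def case_prod_beta
    by (intro vec_angle_measurable borel_measurable_scaleR borel_measurable_const
        measurable_compose[OF _ sndm] borel_measurable_diff measurable_fst measurable_snd)
  have bound: "(\<integral>\<^sup>+X1. ennreal ((k X0 X1)\<^sup>2) * indicator K1 X1 * indicator K2 (X0 - X1) \<partial>lborel) \<le> ennreal (B\<^sup>2)" for X0
    unfolding k_def K1_def K2_def B(2) by (rule nn_integral_angle_cones[OF \<omega> N r M s L])
  note bil = L2_bilinear_bound[OF fL km Km _ _ B(1) bound, folded g_def]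
  have g_int: "AE X0 in lborel. integrable lborel (g X0)"
    and WL: "(\<lambda>X0. \<integral>X1. g X0 X1 \<partial>lborel) \<in> L2_space"
    and Wn: "L2_norm (\<lambda>X0. \<integral>X1. g X0 X1 \<partial>lborel) \<le> B * L2_norm f1 * L2_norm f2"
    using bil by (simp_all add: f1_def f2_def)
  note [measurable] = L2_spaceD(1)[OF fL(1)] L2_spaceD(1)[OF fL(2)] L2_spaceD(1)[OF fourier_L2[OF v1L]]
    L2_spaceD(1)[OF fourier_L2[OF u(2)]]
  have km1[measurable]: "k X0 \<in> borel_measurable borel" for X0
    using measurable_Pair2[OF km, of X0] by simp
  have int_eq: "null_form_integrand s1 s2 v1 u2 X0 = (\<lambda>X1. complex_of_real (k X0 X1) * fourier v1 X1 * fourier u2 (X0 - X1))" for X0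
    by (auto simp: null_form_integrand_def k_def)
  have nm: "null_form_integrand s1 s2 v1 u2 X0 \<in> borel_measurable lborel"
    and gm: "g X0 \<in> borel_measurable lborel" for X0
    unfolding int_eq g_def[abs_def] by measurable
  have AE_eq: "AE X1 in lborel. null_form_integrand s1 s2 v1 u2 X0 X1 = g X0 X1" for X0
    using f1_eq AE_lborel_reflect[OF f2_eq, of X0]
    by eventually_elim (simp add: int_eq g_def)
  have int_iff: "integrable lborel (null_form_integrand s1 s2 v1 u2 X0) \<longleftrightarrow> integrable lborel (g X0)" for X0
    by (rule integrable_cong_AE[OF nm gm AE_eq])
  have int_val: "(\<integral>X1. null_form_integrand s1 s2 v1 u2 X0 X1 \<partial>lborel) = (\<integral>X1. g X0 X1 \<partial>lborel)" for X0
    by (rule integral_cong_AE[OF nm gm AE_eq])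
  \<comment> \<open>Surjectivity turns the bilinear integral into the transform of some
    \<open>w'\<close>. This witness makes the chosen \<open>w\<close> a null form as well, and the
    norm of \<open>w\<close> is then read off from its transform.\<close>
  obtain w' where w': "w' \<in> L2_space" "AE X0 in lborel. fourier w' X0 = (\<integral>X1. g X0 X1 \<partial>lborel)"
    by (rule fourier_surj[OF WL])
  have "is_null_form s1 s2 v1 u2 w'"
    unfolding is_null_form_def int_iff int_val using w' g_int by (auto elim: eventually_elim2)
  then have "\<exists>w. is_null_form s1 s2 v1 u2 w" by blast
  from someI_ex[OF this] show nform: "is_null_form s1 s2 v1 u2 w"
    by (simp add: w_def null_form_def)
  then have w: "w \<in> L2_space" "AE X0 in lborel. fourier w X0 = (\<integral>X1. g X0 X1 \<partial>lborel)"
    unfolding is_null_form_def int_iff int_val by auto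
  have "K * L2_norm w = L2_norm (fourier w)"
    by (rule norm_fourier[OF w(1), symmetric])
  also have "\<dots> = L2_norm (\<lambda>X0. \<integral>X1. g X0 X1 \<partial>lborel)"
    by (intro L2_norm_cong_AE w L2_spaceD(1)[OF WL] L2_spaceD(1)[OF fourier_L2])
  also have "\<dots> \<le> B * L2_norm f1 * L2_norm f2" by (rule Wn)
  also have "\<dots> \<le> B * (K * L2_norm u1) * (K * L2_norm u2)"
    using B K nf by (intro mult_mono mult_left_mono) auto
  also have "\<dots> = K * (B * K * L2_norm u1 * L2_norm u2)" by simp
  finally have "L2_norm w \<le> B * K * L2_norm u1 * L2_norm u2" using K by simp
  then show "L2_norm w \<le> 64 * M\<^sup>2 * sqrt (2 * pi) ^ 3 * sqrt (r * L1 * L2) * L2_norm u1 * L2_norm u2"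
    by (simp add: B_def K_def mult_ac)
qed

text \<open>The conjunct \<open>is_null_form\<close> certifies that the inequality concerns a
  genuine null form with an absolutely convergent integral, not an arbitrary value of
  \<open>SOME\<close>.\<close>

theorem theorem2p3:
  fixes M :: real
  assumes "M \<ge> 1"
  shows "\<exists>C>0. \<forall>N1 N2 L1 L2 s1 s2 r :: real. \<forall>\<omega> :: real ^ 2. \<forall>u1 u2 :: spacetime \<Rightarrow> complex.
    N1 > 0 \<longrightarrow> N2 > 0 \<longrightarrow> L1 > 0 \<longrightarrow> L2 > 0 \<longrightarrow> s1 \<in> {-1, 1} \<longrightarrow> s2 \<in> {-1, 1} \<longrightarrow>
    r > 0 \<longrightarrow> norm \<omega> = 1 \<longrightarrow> u1 \<in> L2_space \<longrightarrow> u2 \<in> L2_space \<longrightarrow>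
    ess_supp (fourier u1) \<subseteq> thick_cone M s1 N1 L1 \<longrightarrow>
    ess_supp (fourier u2) \<subseteq> thick_cone M s2 N2 L2 \<longrightarrow>
    (let v1 = fourier_proj (UNIV \<times> strip r \<omega>) u1;
         w = null_form s1 s2 v1 u2
     in is_null_form s1 s2 v1 u2 w \<and>
        L2_norm w \<le> C * sqrt (r * L1 * L2) * L2_norm u1 * L2_norm u2)"
proof -
  have "0 < 64 * M\<^sup>2 * sqrt (2 * pi) ^ 3" using assms by simp
  then show ?thesis
    unfolding Let_def
    by (intro exI[of _ "64 * M\<^sup>2 * sqrt (2 * pi) ^ 3"] conjI allI impI null_form_estimate[OF assms])
qed

end
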